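(* Let $[R]$ be a toric poset that is not a toric total order (i.e. the underlying graph of its toric transitive closure $\overline{[R]}$ is not complete). Then at least one of the following two steps applies to $[R]$: (A) there are torically incomparable $a,b$ in different connected components of the underlying graph of $[R]$, in which case $\mathcal{L}_{\rm tor}([R])=\mathcal{L}_{\rm tor}([R_{a\to b}])$; replace $[R]$ by $[R_{a\to b}]$; (B) there are torically incomparable $a,b$ at distance two in the underlying graph of $\overline{[R]}$, both adjacent there to some vertex $v$, in which case, for any $R'\in\overline{[R]}$ having $v$ as a source, $\mathcal{L}_{\rm tor}([R])=\mathcal{L}_{\rm tor}([R'_{a\to b}])\sqcup\mathcal{L}_{\rm tor}([R'_{b\to a}])$; replace $[R]$ by the two toric posets $[R'_{a\to b}]$ and $[R'_{b\to a}]$. Consequently, for any toric poset $[Q]$, iterating these steps starting from $[Q]$ is a finite algorithm for finding $\mathcal{L}_{\rm tor}([Q])$: the process terminates, and the resulting toric posets correspond to toric total orders $[w]$, namely exactly the elements of $\mathcal{L}_{\rm tor}([Q])$.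
   Context: All quivers are finite directed graphs that are simple (no loops, no parallel or anti-parallel arcs) and acyclic (no directed cycles), on a vertex set $V=[n]$. A source is a vertex all of whose incident arcs point away from it; a sink is a vertex all of whose incident arcs point into it (an isolated vertex is both). A flip at a source or sink $k$ reverses all arcs incident to $k$. Two acyclic quivers are equivalent if they are related by a finite sequence of flips; the equivalence class $[Q]$ is called a toric poset; all its members have the same underlying undirected graph. If neither $a\to b$ nor $b\to a$ is in $Q$, then $Q_{a\to b}$ is $Q$ with the arc $a\to b$ added (similarly $Q_{b\to a}$). A toric directed path in $Q'$ is a sequence of distinct vertices $y_1,\dots,y_m$ such that $Q'$ contains the arcs $y_1\to y_2\to\cdots\to y_m$ and also the arc $y_1\to y_m$ (a single vertex and a single arc also count). A toric chain of $[Q]$ is a subset of $V$ that is totally ordered in the poset induced by every quiver in $[Q]$ (where $i<j$ if there is a directed path from $i$ to $j$); it is known that a subset is a toric chain if and only if its elements lie on a common toric directed path (in one, equivalently every, $Q'\in[Q]$). Two elements are torically comparable if they lie on a common toric chain, and torically incomparable otherwise. For $Q'\in[Q]$, the toric transitive closure $\overline{Q'}$ is obtained from $Q'$ by adding, for all $i,j$ lying on a common toric chain, the arc $i\to j$ where $i$ precedes $j$ along a toric directed path of $Q'$ containing both. The toric transitive closure of $[Q]$ is $\overline{[Q]}:=[\overline{Q'}]$, known to be independent of the choice of $Q'\in[Q]$. A toric total order $[w]=[(w_1,\dots,w_n)]$ is the equivalence class of a permutation of $V$ under cyclic rotation; it is identified with the toric poset of the acyclic orientation of the complete graph with $w_i\to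 w_j$ for $i<j$. A toric poset whose toric transitive closure has complete underlying graph corresponds to the toric total order given by that closure. For a graph $G$ on $V$, let $\mathcal{A}_{\rm tor}(G)$ be the image in $\mathbb{R}^n/\mathbb{Z}^n$ of $\bigcup_{\{i,j\}\in G}\{x_i=x_j\}\subset\mathbb{R}^n$. A point of $\mathbb{R}^n/\mathbb{Z}^n-\mathcal{A}_{\rm tor}(G)$ determines an acyclic orientation of $G$: $i\to j$ if $x_i \bmod 1< x_j \bmod 1$ (values in $[0,1)$), and $j\to i$ otherwise. For a toric poset $[Q]$ with underlying graph $G$, its toric chamber $c_{[Q]}$ is the set of points whose orientation lies in $[Q]$ (these sets are exactly the connected components of $\mathbb{R}^n/\mathbb{Z}^n-\mathcal{A}_{\rm tor}(G)$). For a toric total order $[w]$, $c_{[w]}$ is the set of points with pairwise distinct coordinates such that listing the indices in increasing order of $x_i\bmod 1$ gives a member of $[w]$. $[w]$ is a toric total extension of $[Q]$ if $c_{[w]}\subseteq c_{[Q]}$; the set of these is $\mathcal{L}_{\rm tor}([Q])$. *)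

theory Defs
  imports "HOL-Analysis.Analysis" "HOL-Library.Multiset"
begin

text \<open>
  The vertex set \<open>[n]\<close> is a type \<open>'n\<close> of class \<open>finite\<close>, and a quiver on it is a relation \<open>Q\<close> with
  \<^prop>\<open>acyclic Q\<close>. A relation has no parallel arcs, and acyclicity excludes loops and anti-parallel
  arcs. Undirected graphs are symmetric relations.
\<close>

section \<open>Toric posets\<close>

definition is_source :: "'n \<Rightarrow> 'n rel \<Rightarrow> bool" where
  "is_source k Q \<longleftrightarrow> (\<forall>i. (i, k) \<notin> Q)"

definition is_sink :: "'n \<Rightarrow> 'n rel \<Rightarrow> bool" where
  "is_sink k Q \<longleftrightarrow> (\<forall>i. (k, i) \<notin> Q)"

definition flip :: "'n \<Rightarrow> 'n rel \<Rightarrow> 'n rel" where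
  "flip k Q = {(i, j) \<in> Q. i \<noteq> k \<and> j \<noteq> k} \<union> {(j, i) | i j. (i, j) \<in> Q \<and> (i = k \<or> j = k)}"

definition flip_step :: "'n rel \<Rightarrow> 'n rel \<Rightarrow> bool" where
  "flip_step Q Q' \<longleftrightarrow> (\<exists>k. (is_source k Q \<or> is_sink k Q) \<and> Q' = flip k Q)"

text \<open>The class \<open>[Q]\<close>. Flips are undone by flips, so \<^term>\<open>flip_step\<^sup>*\<^sup>*\<close> is already symmetric.\<close>

definition toric_class :: "'n rel \<Rightarrow> 'n rel set" where
  "toric_class Q = {Q'. flip_step\<^sup>*\<^sup>* Q Q'}"

text \<open>All members of a toric poset contribute the same graph, see \<open>underlying_graph_toric_class\<close>.\<close>

definition underlying_graph :: "'n rel set \<Rightarrow> 'n rel" where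
  "underlying_graph P = (\<Union>Q\<in>P. Q \<union> Q\<inverse>)"

lemma flip_step_sym_graph:
  assumes "flip_step Q Q'"
  shows "Q' \<union> Q'\<inverse> = Q \<union> Q\<inverse>"
proof -
  obtain k where Q': "Q' = flip k Q"
    using assms by (auto simp: flip_step_def)
  have "(i, j) \<in> Q' \<union> Q'\<inverse> \<longleftrightarrow> (i, j) \<in> Q \<union> Q\<inverse>" for i j
    unfolding Q' flip_def by (cases "i = k \<or> j = k") auto
  then show ?thesis
    by (intro set_eqI) (simp only: split_paired_all)
qed

lemma underlying_graph_toric_class: "underlying_graph (toric_class Q) = Q \<union> Q\<inverse>"
proof -
  have eq: "Q' \<union> Q'\<inverse> = Q \<union> Q\<inverse>" if "Q' \<in> toric_class Q" for Q'
  proof -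
    from that have "flip_step\<^sup>*\<^sup>* Q Q'"
      by (simp add: toric_class_def)
    then show ?thesis
      by (induction rule: rtranclp_induct) (simp_all add: flip_step_sym_graph)
  qed
  have "Q \<in> toric_class Q"
    by (simp add: toric_class_def)
  then have "toric_class Q \<noteq> {}"
    by (metis empty_iff)
  have "underlying_graph (toric_class Q) = (\<Union>Q'\<in>toric_class Q. Q \<union> Q\<inverse>)"
    unfolding underlying_graph_def by (rule SUP_cong[OF refl eq])
  also have "\<dots> = Q \<union> Q\<inverse>"
    using \<open>toric_class Q \<noteq> {}\<close> by (rule SUP_const)
  finally show ?thesis .
qed

definition add_arc :: "'n rel \<Rightarrow> 'n \<Rightarrow> 'n \<Rightarrow> 'n rel" where
  "add_arc Q a b = insert (a, b) Q"


section \<open>Toric chains and toric transitive closure\<close>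

text \<open>For a single vertex there is no arc \<open>y\<^sub>1 \<rightarrow> y\<^sub>m\<close> to ask for; for \<open>m = 2\<close> it is the arc itself.\<close>

definition toric_directed_path :: "'n rel \<Rightarrow> 'n list \<Rightarrow> bool" where
  "toric_directed_path Q ys \<longleftrightarrow>
     ys \<noteq> [] \<and> distinct ys \<and> successively (\<lambda>i j. (i, j) \<in> Q) ys \<and>
     (length ys \<ge> 2 \<longrightarrow> (hd ys, last ys) \<in> Q)"

definition toric_chain :: "'n rel set \<Rightarrow> 'n set \<Rightarrow> bool" where
  "toric_chain P C \<longleftrightarrow> (\<forall>Q\<in>P. total_on C (Q\<^sup>+))"

definition torically_comparable :: "'n rel set \<Rightarrow> 'n \<Rightarrow> 'n \<Rightarrow> bool" where
  "torically_comparable P i j \<longleftrightarrow> (\<exists>C. toric_chain P C \<and> i \<in> C \<and> j \<in> C)"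

definition precedes :: "'n list \<Rightarrow> 'n \<Rightarrow> 'n \<Rightarrow> bool" where
  "precedes ys i j \<longleftrightarrow> (\<exists>k l. k < l \<and> l < length ys \<and> ys ! k = i \<and> ys ! l = j)"

definition toric_trancl :: "'n rel \<Rightarrow> 'n rel" where
  "toric_trancl Q = Q \<union>
     {(i, j). torically_comparable (toric_class Q) i j \<and>
              (\<exists>ys. toric_directed_path Q ys \<and> precedes ys i j)}"

text \<open>
  \<^term>\<open>toric_class (toric_trancl Q)\<close> is the same for all \<^term>\<open>Q\<close> in a toric poset, so for a toric
  poset this union is that common class.
\<close>

definition toric_closure :: "'n rel set \<Rightarrow> 'n rel set" where
  "toric_closure P = (\<Union>Q\<in>P. toric_class (toric_trancl Q))"

definition closure_complete :: "'n rel set \<Rightarrow> bool" where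
  "closure_complete P \<longleftrightarrow> (\<forall>i j. i \<noteq> j \<longrightarrow> (i, j) \<in> underlying_graph (toric_closure P))"


section \<open>Toric total orders\<close>

definition rotation_class :: "'n list \<Rightarrow> 'n list set" where
  "rotation_class w = {rotate k w | k. True}"

definition toric_total_order :: "'n list set \<Rightarrow> bool" where
  "toric_total_order W \<longleftrightarrow> (\<exists>w. distinct w \<and> set w = UNIV \<and> W = rotation_class w)"

text \<open>
  The toric poset identified with \<open>[w]\<close>. Cyclic rotation of \<open>w\<close> moves a source of the corresponding
  orientation of the complete graph to the end, i.e. flips it, so all terms of the union agree.
\<close>

definition poset_of_total_order :: "'n list set \<Rightarrow> 'n rel set" where
  "poset_of_total_order W = (\<Union>w\<in>W. toric_class {(i, j). precedes w i j})"

definition corresponds :: "'n rel set \<Rightarrow> 'n list set \<Rightarrow> bool" where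
  "corresponds P W \<longleftrightarrow>
     closure_complete P \<and> toric_total_order W \<and> toric_closure P = poset_of_total_order W"


section \<open>Toric chambers and toric total extensions\<close>

definition torus_rel :: "(real ^ 'n::finite) rel" where
  "torus_rel = {(x, y). \<forall>i. x $ i - y $ i \<in> \<int>}"

definition torus :: "(real ^ 'n::finite) set set" where
  "torus = UNIV // torus_rel"

definition torus_proj :: "real ^ 'n::finite \<Rightarrow> (real ^ 'n) set" where
  "torus_proj x = torus_rel `` {x}"

text \<open>The value \<open>x\<^sub>i mod 1 \<in> [0, 1)\<close> at a point of the torus; independent of the representative.\<close>

definition torus_coord :: "(real ^ 'n::finite) set \<Rightarrow> 'n \<Rightarrow> real" where
  "torus_coord p i = the_elem ((\<lambda>x. frac (x $ i)) ` p)"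

lemma torus_coord_proj: "torus_coord (torus_proj x) i = frac (x $ i)"
proof -
  have "frac (y $ i) = frac (x $ i)" if "y \<in> torus_proj x" for y
  proof -
    from that have "x $ i - y $ i \<in> \<int>"
      by (simp add: torus_proj_def torus_rel_def)
    then obtain m where "x $ i - y $ i = of_int m"
      by (rule Ints_cases)
    then have "x $ i = y $ i + of_int m"
      by simp
    then show ?thesis
      by (simp add: frac_def)
  qed
  moreover have "x \<in> torus_proj x"
    by (simp add: torus_proj_def torus_rel_def)
  then have "torus_proj x \<noteq> {}"
    by (metis empty_iff)
  ultimately show ?thesis
    unfolding torus_coord_def by (intro the_elem_image_unique)
qed

definition toric_arrangement :: "'n::finite rel \<Rightarrow> (real ^ 'n) set set" where
  "toric_arrangement G = torus_proj ` (\<Union>(i, j)\<in>G. {x. x $ i = x $ j})"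

text \<open>
  Only meaningful for points off \<^term>\<open>toric_arrangement G\<close>, where the two coordinates along any
  edge differ.
\<close>

definition point_orientation :: "'n::finite rel \<Rightarrow> (real ^ 'n) set \<Rightarrow> 'n rel" where
  "point_orientation G p = {(i, j) \<in> G. torus_coord p i < torus_coord p j}"

definition toric_chamber :: "'n::finite rel set \<Rightarrow> (real ^ 'n) set set" where
  "toric_chamber P =
     {p \<in> torus - toric_arrangement (underlying_graph P).
        point_orientation (underlying_graph P) p \<in> P}"

definition total_order_chamber :: "'n::finite list set \<Rightarrow> (real ^ 'n) set set" where
  "total_order_chamber W =
     {p \<in> torus. inj (torus_coord p) \<and>
        (\<exists>w\<in>W. sorted_wrt (\<lambda>i j. torus_coord p i < torus_coord p j) w)}"

definition toric_total_extensions :: "'n::finite rel set \<Rightarrow> 'n list set set" where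
  "toric_total_extensions P =
     {W. toric_total_order W \<and> total_order_chamber W \<subseteq> toric_chamber P}"

lemma finite_toric_total_extensions: "finite (toric_total_extensions (P :: 'n::finite rel set))"
proof (rule finite_subset)
  show "toric_total_extensions P \<subseteq> rotation_class ` {w. set w \<subseteq> UNIV \<and> distinct w}"
    by (auto simp: toric_total_extensions_def toric_total_order_def)
  show "finite (rotation_class ` {w :: 'n list. set w \<subseteq> UNIV \<and> distinct w})"
    by (intro finite_imageI finite_subset_distinct finite)
qed


section \<open>The algorithm\<close>

definition at_distance :: "'n rel \<Rightarrow> nat \<Rightarrow> 'n \<Rightarrow> 'n \<Rightarrow> bool" where
  "at_distance G d a b \<longleftrightarrow> (a, b) \<in> G ^^ d \<and> (\<forall>k<d. (a, b) \<notin> G ^^ k)"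

definition condition_A :: "'n rel set \<Rightarrow> 'n \<Rightarrow> 'n \<Rightarrow> bool" where
  "condition_A P a b \<longleftrightarrow>
     \<not> torically_comparable P a b \<and> (a, b) \<notin> (underlying_graph P)\<^sup>*"

definition condition_B :: "'n rel set \<Rightarrow> 'n \<Rightarrow> 'n \<Rightarrow> 'n \<Rightarrow> bool" where
  "condition_B P a b v \<longleftrightarrow>
     \<not> torically_comparable P a b \<and>
     at_distance (underlying_graph (toric_closure P)) 2 a b \<and>
     (v, a) \<in> underlying_graph (toric_closure P) \<and> (v, b) \<in> underlying_graph (toric_closure P)"

text \<open>
  A state is the collection of toric posets currently held. It is a multiset, so that a poset
  produced twice would be recorded twice. A step treats one of them, with an arbitrary choice of
  the vertices and of the representative.
\<close>

inductive algorithm_step :: "'n rel set multiset \<Rightarrow> 'n rel set multiset \<Rightarrow> bool" where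
  step_A: "algorithm_step (add_mset P M) (add_mset (toric_class (add_arc R a b)) M)"
    if "condition_A P a b" "R \<in> P"
| step_B: "algorithm_step (add_mset P M)
     (add_mset (toric_class (add_arc R' a b)) (add_mset (toric_class (add_arc R' b a)) M))"
    if "condition_B P a b v" "R' \<in> toric_closure P" "is_source v R'"

end

theory Submission
  imports Defs
begin

text \<open>
  Flips are tracked by an integer height function: if \<open>x\<close> is a real point with \<open>0 < x\<^sub>j - x\<^sub>i < 1\<close>
  for every arc \<open>i \<rightarrow> j\<close> and \<open>h\<close> is its integer part, then \<open>h\<^sub>j - h\<^sub>i \<in> {0, 1}\<close> along arcs, and the
  orientation of the fractional part reverses the arcs on which \<open>h\<close> grows. The members of \<open>[Q]\<close>
  are exactly these reorientations. Height functions of \<open>Q\<close> are also height functions of its toric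
  transitive closure, so a toric total order extends \<open>[Q]\<close> iff it extends the closure. In step A,
  the heights on the component of \<open>b\<close> can be shifted freely to orient the new arc. In step B, the
  common neighbour \<open>v\<close> forces the heights of \<open>a\<close> and \<open>b\<close> to differ by at most one, so exactly one
  of the two new arcs fits. Each step makes at least one more pair of vertices comparable.
\<close>

section \<open>Height functions\<close>

definition height_fun :: "('n \<Rightarrow> int) \<Rightarrow> 'n rel \<Rightarrow> bool" where
  "height_fun h Q \<longleftrightarrow> (\<forall>(i, j)\<in>Q. h j = h i \<or> h j = h i + 1)"

text \<open>An arc on which \<open>h\<close> changes by anything but 0 or 1 disappears from
  \<open>shift h Q\<close>; where the graph must survive, \<open>height_fun h Q\<close> is assumed
  as well.\<close>

definition shift :: "('n \<Rightarrow> int) \<Rightarrow> 'n rel \<Rightarrow> 'n rel" where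
  "shift h Q = {(i, j). (i, j) \<in> Q \<and> h j = h i \<or> (j, i) \<in> Q \<and> h i = h j + 1}"

lemma height_funD: "height_fun h Q \<Longrightarrow> (i, j) \<in> Q \<Longrightarrow> h j = h i \<or> h j = h i + 1"
  by (auto simp: height_fun_def)

lemma height_fun_mono: "height_fun h Q' \<Longrightarrow> Q \<subseteq> Q' \<Longrightarrow> height_fun h Q"
  by (auto simp: height_fun_def)

lemma shift_mono: "Q \<subseteq> Q' \<Longrightarrow> shift h Q \<subseteq> shift h Q'"
  by (auto simp: shift_def)

lemma shift_const: "shift (\<lambda>_. c) Q = Q"
  by (auto simp: shift_def)

lemma shift_add_arc:
  "shift h (add_arc Q a b) =
     shift h Q \<union> (if h b = h a then {(a, b)} else {}) \<union> (if h b = h a + 1 then {(b, a)} else {})"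
  by (auto simp: shift_def add_arc_def)

lemma height_fun_add_arc:
  "height_fun h (add_arc Q a b) \<longleftrightarrow> height_fun h Q \<and> (h b = h a \<or> h b = h a + 1)"
  by (auto simp: height_fun_def add_arc_def)

lemma shift_graph:
  assumes "height_fun h Q"
  shows "shift h Q \<union> (shift h Q)\<inverse> = Q \<union> Q\<inverse>"
  using height_funD[OF assms] by (fastforce simp: shift_def)

lemma height_fun_rtrancl:
  assumes "height_fun h Q" "(i, j) \<in> Q\<^sup>*"
  shows "h i \<le> h j"
  using assms(2)
proof induction
  case (step y z)
  then show ?case using height_funD[OF assms(1), of y z] by auto
qed simp

text \<open>Heights are monotone along paths of \<open>Q\<close>, so equal heights at the ends force
  a constant height in between, and no arc of the path is reversed.\<close>

lemma shift_rtrancl: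
  assumes "height_fun h Q" "(i, j) \<in> Q\<^sup>*" "h i = h j"
  shows "(i, j) \<in> (shift h Q)\<^sup>*"
  using assms(2,3)
proof induction
  case (step y z)
  have "h i \<le> h y" "h y \<le> h z"
    using height_fun_rtrancl[OF assms(1)] step.hyps by auto
  with step have "(i, y) \<in> (shift h Q)\<^sup>*" "(y, z) \<in> shift h Q"
    by (auto simp: shift_def)
  then show ?case by simp
qed simp

lemma shift_rtrancl_height:
  assumes "(i, j) \<in> (shift h Q)\<^sup>*"
  shows "h j \<le> h i"
  using assms by induction (auto simp: shift_def)

text \<open>Arcs of the shift never go up in height. A path returning to its initial height
  therefore consists of kept arcs only.\<close>

lemma shift_trancl_const_height:
  assumes "(i, j) \<in> (shift h Q)\<^sup>+" "h i = h j"
  shows "(i, j) \<in> Q\<^sup>+"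
  using assms
proof induction
  case (step y z)
  have "h y \<le> h i" "h z \<le> h y"
    using shift_rtrancl_height[OF trancl_into_rtrancl[OF step.hyps(1)]]
      shift_rtrancl_height[OF r_into_rtrancl[OF step.hyps(2)]] by auto
  with step have "(i, y) \<in> Q\<^sup>+" "(y, z) \<in> Q"
    by (auto simp: shift_def)
  then show ?case by simp
qed (auto simp: shift_def)

lemma acyclic_shift:
  assumes "acyclic Q"
  shows "acyclic (shift h Q)"
  using assms shift_trancl_const_height by (fastforce simp: acyclic_def)

text \<open>Heights add because no arc is raised twice: once \<open>h\<close> has grown along i ->
  j, the arc is reversed, and \<open>h'\<close> can only stay constant or take the growth
  back.\<close>

lemma shift_shift:
  assumes "height_fun h Q" "height_fun h' (shift h Q)"
  shows "height_fun (\<lambda>i. h i + h' i) Q" "shift h' (shift h Q) = shift (\<lambda>i. h i + h' i) Q"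
proof -
  have *: "h j = h i \<and> (h' j = h' i \<or> h' j = h' i + 1) \<or>
      h j = h i + 1 \<and> (h' i = h' j \<or> h' i = h' j + 1)" if "(i, j) \<in> Q" for i j
    using height_funD[OF assms(1) that] height_funD[OF assms(2), of i j]
      height_funD[OF assms(2), of j i] that
    by (auto simp: shift_def)
  then show "height_fun (\<lambda>i. h i + h' i) Q"
    by (fastforce simp: height_fun_def)
  show "shift h' (shift h Q) = shift (\<lambda>i. h i + h' i) Q"
    using * by (fastforce simp: shift_def)
qed

section \<open>Flips as shifts by a height function\<close>

lemma flip_source:
  assumes "is_source k Q"
  defines "h \<equiv> (\<lambda>i. if i = k then - 1 else 0)"
  shows "height_fun h Q" "flip k Q = shift h Q"
  using assms by (auto simp: is_source_def height_fun_def flip_def shift_def split: if_splits)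

lemma flip_sink:
  assumes "is_sink k Q"
  defines "h \<equiv> (\<lambda>i. if i = k then 1 else 0)"
  shows "height_fun h Q" "flip k Q = shift h Q"
  using assms by (auto simp: is_sink_def height_fun_def flip_def shift_def split: if_splits)

lemma flip_step_shift:
  assumes "flip_step Q Q'"
  shows "\<exists>h. height_fun h Q \<and> Q' = shift h Q"
  using assms flip_source flip_sink unfolding flip_step_def by metis

lemma toric_class_shift:
  assumes "Q' \<in> toric_class Q"
  obtains h where "height_fun h Q" "Q' = shift h Q"
proof -
  have "flip_step\<^sup>*\<^sup>* Q Q'"
    using assms by (simp add: toric_class_def)
  then have "\<exists>h. height_fun h Q \<and> Q' = shift h Q"
  proof induction
    case base
    have "height_fun (\<lambda>_. 0) Q" by (simp add: height_fun_def)
    then show ?case using shift_const by metis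
  next
    case (step Q' Q'')
    then show ?case using shift_shift flip_step_shift by metis
  qed
  then show ?thesis using that by blast
qed

lemma flip_flip:
  assumes "is_source k Q \<or> is_sink k Q"
  shows "flip k (flip k Q) = Q" "is_source k (flip k Q) \<or> is_sink k (flip k Q)"
  using assms by (auto simp: flip_def is_source_def is_sink_def)

lemma symp_flip_step: "symp flip_step"
  unfolding symp_def flip_step_def using flip_flip by metis

lemma toric_class_eq:
  assumes "Q' \<in> toric_class Q"
  shows "toric_class Q' = toric_class Q"
proof -
  have "flip_step\<^sup>*\<^sup>* Q Q'" "flip_step\<^sup>*\<^sup>* Q' Q"
    using assms sympD[OF symp_rtranclp[OF symp_flip_step]] by (auto simp: toric_class_def)
  then show ?thesis
    by (auto simp: toric_class_def)
qed

lemma self_in_toric_class [simp]: "Q \<in> toric_class Q"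
  by (simp add: toric_class_def)

lemma acyclic_toric_class: "acyclic Q \<Longrightarrow> Q' \<in> toric_class Q \<Longrightarrow> acyclic Q'"
  by (metis toric_class_shift acyclic_shift)

lemma flip_in_toric_class: "is_source k Q \<or> is_sink k Q \<Longrightarrow> flip k Q \<in> toric_class Q"
  unfolding toric_class_def flip_step_def by blast

text \<open>Converse of \<open>toric_class_shift\<close>, by induction on the total gap between
  \<open>h\<close> and a fixed upper bound \<open>H\<close>. Unless \<open>h\<close> is constantly
  \<open>H\<close>, a lowest vertex is flipped as a source and its height raised by one, which
  leaves the resulting shift unchanged and closes part of the gap.\<close>

lemma shift_in_toric_class:
  fixes Q :: "'n::finite rel"
  assumes "acyclic Q" "height_fun h Q"
  shows "shift h Q \<in> toric_class Q"
proof -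
  define H where "H = Max (range h)"
  have "\<forall>i. h i \<le> H" by (simp add: H_def)
  with assms show ?thesis
  proof (induction "nat (\<Sum>i\<in>UNIV. H - h i)" arbitrary: Q h rule: less_induct)
    case less
    show ?case
    proof (cases "\<forall>i. h i = H")
      case True
      then have "h = (\<lambda>_. H)" by auto
      then show ?thesis by (simp add: shift_const)
    next
      case False
      define m where "m = Min (range h)"
      have m: "m \<le> h i" for i by (simp add: m_def)
      have "m \<in> range h" unfolding m_def by (intro Min_in) auto
      then obtain k0 where k0: "h k0 = m" by auto
      have "wf Q" using less.prems(1) by (simp add: finite_acyclic_wf)
      \<comment> \<open>\<open>k\<close> is minimal for \<open>Q\<close> inside the lowest level set
        of \<open>h\<close>. An arc into \<open>k\<close> starts no higher than \<open>k\<close>,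
        hence in that level set, so \<open>k\<close> is a source of all of \<open>Q\<close>.\<close>
      then obtain k where k: "h k = m" and kmin: "\<And>i. (i, k) \<in> Q \<Longrightarrow> h i \<noteq> m"
        using wfE_min[of Q k0 "{i. h i = m}"] k0 by auto
      \<comment> \<open>There is room above the lowest value, so raising \<open>k\<close> by one
        does not pass \<open>H\<close>.\<close>
      have "m < H"
        using False m less.prems(3) by (metis order.antisym less_le order_trans)
      have src: "is_source k Q"
        unfolding is_source_def
      proof (intro allI notI)
        fix i assume "(i, k) \<in> Q"
        then show False
          using kmin[of i] height_funD[OF less.prems(2), of i k] m[of i] k by auto
      qed
      define h' where "h' = h(k := h k + 1)"
      have noloop: "(k, k) \<notin> Q" using src by (simp add: is_source_def)
      have hk: "height_fun h' (flip k Q)"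
        using less.prems(2) src noloop
        by (fastforce simp: height_fun_def flip_def h'_def is_source_def)
      have flip_eq: "shift h' (flip k Q) = shift h Q"
      proof -
        have "height_fun (\<lambda>i. if i = k then - 1 else 0) Q"
          "flip k Q = shift (\<lambda>i. if i = k then - 1 else 0) Q"
          using flip_source[OF src] by auto
        moreover from this have "shift h' (flip k Q) = shift (\<lambda>i. (if i = k then - 1 else 0) + h' i) Q"
          using shift_shift hk by metis
        moreover have "(\<lambda>i. (if i = k then - 1 else 0) + h' i) = h"
          by (auto simp: h'_def)
        ultimately show ?thesis by simp
      qed
      have "(\<Sum>i\<in>UNIV. H - h' i) < (\<Sum>i\<in>UNIV. H - h i)"
        by (rule sum_strict_mono_ex1) (auto simp: h'_def)
      moreover have "(\<Sum>i\<in>UNIV. H - h' i) \<ge> 0"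
        using less.prems(3) \<open>m < H\<close> k by (intro sum_nonneg) (auto simp: h'_def)
      ultimately have "nat (\<Sum>i\<in>UNIV. H - h' i) < nat (\<Sum>i\<in>UNIV. H - h i)"
        by linarith
      moreover have "acyclic (flip k Q)"
        using acyclic_toric_class less.prems(1) flip_in_toric_class src by metis
      moreover have "\<forall>i. h' i \<le> H"
        using less.prems(3) \<open>m < H\<close> k by (auto simp: h'_def)
      ultimately have "shift h' (flip k Q) \<in> toric_class (flip k Q)"
        using less.hyps hk by blast
      then show ?thesis
        using toric_class_eq[OF flip_in_toric_class] src flip_eq by metis
    qed
  qed
qed

section \<open>Toric comparability and toric transitive closure\<close>

text \<open>Subsets of toric chains are toric chains, so it is enough to test the pair itself in
  every member of the class.\<close>

lemma torically_comparable_iff: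
  "torically_comparable P i j \<longleftrightarrow> (\<forall>Q\<in>P. i = j \<or> (i, j) \<in> Q\<^sup>+ \<or> (j, i) \<in> Q\<^sup>+)"
proof
  assume "\<forall>Q\<in>P. i = j \<or> (i, j) \<in> Q\<^sup>+ \<or> (j, i) \<in> Q\<^sup>+"
  then have "toric_chain P {i, j}"
    by (auto simp: toric_chain_def total_on_def)
  then show "torically_comparable P i j"
    unfolding torically_comparable_def by blast
qed (auto simp: torically_comparable_def toric_chain_def total_on_def)

lemma torically_comparable_sym: "torically_comparable P i j \<longleftrightarrow> torically_comparable P j i"
  by (auto simp: torically_comparable_iff)

text \<open>
  If no arc \<open>s \<rightarrow> t\<close> spans \<open>i\<close> and \<open>j\<close>, then reversing all arcs that leave the down-set of \<open>i\<close>
  makes \<open>i\<close> and \<open>j\<close> incomparable.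
\<close>

lemma torically_comparable_imp_spanned:
  fixes Q :: "'n::finite rel"
  assumes "acyclic Q" "(i, j) \<in> Q\<^sup>+" "torically_comparable (toric_class Q) i j"
  obtains s t where "(s, t) \<in> Q" "(s, i) \<in> Q\<^sup>*" "(j, t) \<in> Q\<^sup>*"
proof -
  define h where "h x = (if (x, i) \<in> Q\<^sup>* then 0 else 1 :: int)" for x
  have h: "height_fun h Q"
    by (auto simp: height_fun_def h_def intro: converse_rtrancl_into_rtrancl)
  have ne: "i \<noteq> j" "(j, i) \<notin> Q\<^sup>*"
    using assms(1,2) by (auto simp: acyclic_def dest: trancl_rtrancl_trancl)
  then have hij: "h i = 0" "h j = 1" by (auto simp: h_def)
  have "(i, j) \<notin> (shift h Q)\<^sup>+"
    using shift_rtrancl_height[OF trancl_into_rtrancl, of i j h Q] hij by auto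
  then have "(j, i) \<in> (shift h Q)\<^sup>*"
    using shift_in_toric_class[OF assms(1) h] assms(3) ne
    by (auto simp: torically_comparable_iff)
  \<comment> \<open>A path of the shift starting at \<open>j\<close> runs at height 1 along arcs of
    \<open>Q\<close> until it first drops to height 0. The drop uses a reversed arc s -> t of
    \<open>Q\<close>, with \<open>s\<close> in the down-set of \<open>i\<close> and \<open>t\<close>
    reachable from \<open>j\<close>.\<close>
  moreover have "h x = 1 \<and> (j, x) \<in> Q\<^sup>* \<or> (\<exists>s t. (s, t) \<in> Q \<and> (s, i) \<in> Q\<^sup>* \<and> (j, t) \<in> Q\<^sup>*)"
    if "(j, x) \<in> (shift h Q)\<^sup>*" for x
    using that
  proof induction
    case base
    then show ?case using hij by simp
  next
    case (step y z)
    then show ?case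
      by (auto simp: shift_def h_def split: if_splits intro: rtrancl_into_rtrancl)
  qed
  ultimately have "\<exists>s t. (s, t) \<in> Q \<and> (s, i) \<in> Q\<^sup>* \<and> (j, t) \<in> Q\<^sup>*"
    using hij by fastforce
  then show ?thesis using that by blast
qed

text \<open>Over the arc s -> t the height grows by at most one, so it grows on at most one of the
  segments s..i, i..j, j..t. If it is constant on i..j, that path survives. Otherwise the two outer
  segments survive and the reversed arc t -> s joins them to a path from \<open>j\<close> to
  \<open>i\<close>.\<close>

lemma spanned_imp_torically_comparable:
  fixes Q :: "'n::finite rel"
  assumes "(s, t) \<in> Q" "(s, i) \<in> Q\<^sup>*" "(i, j) \<in> Q\<^sup>*" "(j, t) \<in> Q\<^sup>*"
  shows "torically_comparable (toric_class Q) i j"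
  unfolding torically_comparable_iff
proof
  fix Q' assume "Q' \<in> toric_class Q"
  then obtain h where h: "height_fun h Q" "Q' = shift h Q"
    by (rule toric_class_shift)
  note le = height_fun_rtrancl[OF h(1)]
  have "h s \<le> h i" "h i \<le> h j" "h j \<le> h t" "h t \<le> h s + 1"
    using le assms height_funD[OF h(1), of s t] by auto
  then consider "h i = h j" | "h s = h i" "h j = h t" "h t = h s + 1"
    by linarith
  then show "i = j \<or> (i, j) \<in> Q'\<^sup>+ \<or> (j, i) \<in> Q'\<^sup>+"
  proof cases
    case 1
    then have "(i, j) \<in> Q'\<^sup>*" using shift_rtrancl h assms by auto
    then show ?thesis by (auto simp: rtrancl_eq_or_trancl)
  next
    case 2
    then have "(j, t) \<in> Q'\<^sup>*" "(s, i) \<in> Q'\<^sup>*"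
      using shift_rtrancl[OF h(1) assms(4) 2(2)] shift_rtrancl[OF h(1) assms(2) 2(1)] h(2)
      by simp_all
    moreover have "(t, s) \<in> Q'"
      using 2 h assms by (auto simp: shift_def)
    ultimately have "(j, i) \<in> Q'\<^sup>+"
      by (meson rtrancl_into_trancl1 trancl_rtrancl_trancl)
    then show ?thesis by blast
  qed
qed

lemma arc_imp_torically_comparable:
  fixes Q :: "'n::finite rel"
  assumes "(i, j) \<in> Q \<union> Q\<inverse>"
  shows "torically_comparable (toric_class Q) i j"
  using assms spanned_imp_torically_comparable[of i j Q i j]
    spanned_imp_torically_comparable[of j i Q j i] torically_comparable_sym[of _ i j] by auto

section \<open>Toric directed paths through a spanned pair\<close>

lemma prepend_path:
  assumes "(x, y) \<in> Q\<^sup>*" "ws \<noteq> []" "hd ws = y" "successively (\<lambda>i j. (i, j) \<in> Q) ws"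
  shows "\<exists>us. us @ ws \<noteq> [] \<and> hd (us @ ws) = x \<and> successively (\<lambda>i j. (i, j) \<in> Q) (us @ ws)"
  using assms(1)
proof (induction rule: converse_rtrancl_induct)
  case base
  then show ?case using assms by (intro exI[of _ "[]"]) auto
next
  case (step x z)
  then obtain us where us: "us @ ws \<noteq> []" "hd (us @ ws) = z"
    "successively (\<lambda>i j. (i, j) \<in> Q) (us @ ws)" by blast
  then have "successively (\<lambda>i j. (i, j) \<in> Q) ((x # us) @ ws)"
    using step.hyps by (cases "us @ ws") (auto simp: successively_Cons)
  then show ?case by (intro exI[of _ "x # us"]) auto
qed

lemma successively_precedes:
  assumes "successively (\<lambda>i j. (i, j) \<in> Q) ys" "precedes ys i j"
  shows "(i, j) \<in> Q\<^sup>+"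
proof -
  have "successively (\<lambda>i j. (i, j) \<in> Q\<^sup>+) ys"
    using assms(1) by (rule successively_mono) auto
  then have "sorted_wrt (\<lambda>i j. (i, j) \<in> Q\<^sup>+) ys"
    by (subst (asm) successively_conv_sorted_wrt) (auto simp: transp_def)
  then show ?thesis
    using assms(2) by (auto simp: precedes_def sorted_wrt_iff_nth_less)
qed

lemma precedes_total:
  assumes "i \<in> set ys" "j \<in> set ys" "i \<noteq> j"
  shows "precedes ys i j \<or> precedes ys j i"
  using assms unfolding precedes_def in_set_conv_nth by (metis linorder_neq_iff)

text \<open>The path is assembled from its end: \<open>t\<close>, then j..t, i..j and s..i.
  Acyclicity makes it distinct, since a repeated vertex would lie on a cycle, and the arc s -> t
  closes it.\<close>

lemma spanned_imp_toric_directed_path: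
  assumes "acyclic Q" "(s, t) \<in> Q" "(s, i) \<in> Q\<^sup>*" "(i, j) \<in> Q\<^sup>+" "(j, t) \<in> Q\<^sup>*"
  shows "\<exists>ys. toric_directed_path Q ys \<and> precedes ys i j"
proof -
  obtain us where us: "hd (us @ [t]) = j" "successively (\<lambda>i j. (i, j) \<in> Q) (us @ [t])"
    using prepend_path[OF assms(5), of "[t]"] by auto
  obtain vs where vs: "hd (vs @ us @ [t]) = i" "successively (\<lambda>i j. (i, j) \<in> Q) (vs @ us @ [t])"
    using prepend_path[OF trancl_into_rtrancl[OF assms(4)], of "us @ [t]"] us by auto
  obtain ws where ws: "hd (ws @ vs @ us @ [t]) = s"
    "successively (\<lambda>i j. (i, j) \<in> Q) (ws @ vs @ us @ [t])"
    using prepend_path[of s i Q "vs @ us @ [t]"] vs assms(3) by auto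
  define ys where "ys = ws @ vs @ us @ [t]"
  have acyc: "(x, x) \<notin> Q\<^sup>+" for x
    using assms(1) by (simp add: acyclic_def)
  have ys: "hd ys = s" "last ys = t" "successively (\<lambda>i j. (i, j) \<in> Q) ys" "ys \<noteq> []"
    using ws by (auto simp: ys_def)
  have "i \<in> set ys" "j \<in> set ys"
    using us(1) vs(1) hd_in_set[of "us @ [t]"] hd_in_set[of "vs @ us @ [t]"]
    by (auto simp: ys_def simp del: hd_append hd_append2)
  moreover have "i \<noteq> j" "\<not> precedes ys j i"
    using acyc assms(4) successively_precedes[OF ys(3), of j i] by (auto dest: trancl_trans)
  ultimately have "precedes ys i j"
    using precedes_total by metis
  moreover have "distinct ys"
    unfolding distinct_conv_nth
  proof (intro allI impI)
    fix k l assume "k < length ys" "l < length ys" "k \<noteq> l"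
    then have "precedes ys (ys ! k) (ys ! l) \<or> precedes ys (ys ! l) (ys ! k)"
      unfolding precedes_def by (metis linorder_neq_iff)
    then show "ys ! k \<noteq> ys ! l"
      using successively_precedes[OF ys(3)] acyc by metis
  qed
  ultimately show ?thesis
    using ys assms(2) unfolding toric_directed_path_def by blast
qed

text \<open>The arc spanning a comparable pair supplies the toric directed path, so mere
  reachability can replace it. From here on the closure is handled without lists of
  vertices.\<close>

lemma toric_trancl_eq:
  fixes Q :: "'n::finite rel"
  assumes "acyclic Q"
  shows "toric_trancl Q = {(i, j) \<in> Q\<^sup>+. torically_comparable (toric_class Q) i j}"
proof (intro subset_antisym subrelI)
  fix i j assume "(i, j) \<in> toric_trancl Q"
  then show "(i, j) \<in> {(i, j) \<in> Q\<^sup>+. torically_comparable (toric_class Q) i j}"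
    using successively_precedes[of Q _ i j] arc_imp_torically_comparable[of i j Q]
    by (auto simp: toric_trancl_def toric_directed_path_def)
next
  fix i j assume *: "(i, j) \<in> {(i, j) \<in> Q\<^sup>+. torically_comparable (toric_class Q) i j}"
  then obtain s t where "(s, t) \<in> Q" "(s, i) \<in> Q\<^sup>*" "(j, t) \<in> Q\<^sup>*"
    using torically_comparable_imp_spanned[OF assms, of i j] by auto
  then show "(i, j) \<in> toric_trancl Q"
    using spanned_imp_toric_directed_path[OF assms] * by (auto simp: toric_trancl_def)
qed

lemma toric_trancl_supset: "Q \<subseteq> toric_trancl Q"
  by (auto simp: toric_trancl_def)

lemma acyclic_toric_trancl:
  fixes Q :: "'n::finite rel"
  assumes "acyclic Q"
  shows "acyclic (toric_trancl Q)"
proof -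
  have "acyclic (Q\<^sup>+)" using assms by (simp add: acyclic_def)
  then show ?thesis
    by (rule acyclic_subset) (auto simp: toric_trancl_eq[OF assms])
qed

text \<open>A closure arc lies between the ends of an arc of \<open>Q\<close>, over which
  \<open>h\<close> grows by at most one; monotonicity along paths passes this bound on to the new
  arc.\<close>

lemma height_fun_toric_trancl:
  fixes Q :: "'n::finite rel"
  assumes "acyclic Q" "height_fun h Q"
  shows "height_fun h (toric_trancl Q)"
proof -
  have "h j = h i \<or> h j = h i + 1" if "(i, j) \<in> toric_trancl Q" for i j
  proof -
    have ij: "(i, j) \<in> Q\<^sup>+" "torically_comparable (toric_class Q) i j"
      using that by (auto simp: toric_trancl_eq[OF assms(1)])
    then obtain s t where "(s, t) \<in> Q" "(s, i) \<in> Q\<^sup>*" "(j, t) \<in> Q\<^sup>*"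
      using torically_comparable_imp_spanned[OF assms(1)] by metis
    then have "h s \<le> h i" "h i \<le> h j" "h j \<le> h t" "h t \<le> h s + 1"
      using height_fun_rtrancl[OF assms(2)] height_funD[OF assms(2), of s t]
        trancl_into_rtrancl[OF ij(1)] by auto
    then show ?thesis by linarith
  qed
  then show ?thesis by (auto simp: height_fun_def)
qed

lemma toric_trancl_total_iff:
  fixes Q :: "'n::finite rel"
  assumes "acyclic Q"
  shows "(i, j) \<in> toric_trancl Q \<union> (toric_trancl Q)\<inverse> \<longleftrightarrow>
    i \<noteq> j \<and> torically_comparable (toric_class Q) i j"
proof -
  have "(k, k) \<notin> Q\<^sup>+" for k
    using assms by (simp add: acyclic_def)
  moreover have "i = j \<or> (i, j) \<in> Q\<^sup>+ \<or> (j, i) \<in> Q\<^sup>+"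
    if "torically_comparable (toric_class Q) i j"
    using that self_in_toric_class[of Q] unfolding torically_comparable_iff by blast
  ultimately show ?thesis
    unfolding toric_trancl_eq[OF assms] using torically_comparable_sym[of "toric_class Q" i j]
    by blast
qed

text \<open>Both sides have the same underlying graph, because comparability depends only on the
  class. An edge directed oppositely on the two sides would have equal heights at its ends and so
  give paths of \<open>Q\<close> in both directions; hence the two acyclic orientations
  agree.\<close>

lemma shift_toric_trancl:
  fixes Q :: "'n::finite rel"
  assumes "acyclic Q" "height_fun h Q"
  shows "shift h (toric_trancl Q) = toric_trancl (shift h Q)"
proof -
  define Q' where "Q' = shift h Q"
  have Q': "Q' \<in> toric_class Q"
    using assms by (simp add: Q'_def shift_in_toric_class)
  have ac: "acyclic Q'" using Q' assms(1) by (rule acyclic_toric_class[rotated])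
  have total: "(i, j) \<in> toric_trancl Q' \<union> (toric_trancl Q')\<inverse> \<longleftrightarrow>
      (i, j) \<in> toric_trancl Q \<union> (toric_trancl Q)\<inverse>" for i j
    by (simp add: toric_trancl_total_iff ac assms(1) toric_class_eq[OF Q'] del: Un_iff)
  have one: "(i, j) \<in> toric_trancl Q'" if "(i, j) \<in> shift h (toric_trancl Q)" for i j
  proof (rule ccontr)
    assume *: "(i, j) \<notin> toric_trancl Q'"
    have "(i, j) \<in> toric_trancl Q \<union> (toric_trancl Q)\<inverse>"
      using that by (auto simp: shift_def)
    with * total have "(j, i) \<in> toric_trancl Q'" by blast
    then have ji: "(j, i) \<in> Q'\<^sup>+" by (auto simp: toric_trancl_eq[OF ac])
    then have "h i \<le> h j"
      unfolding Q'_def by (intro shift_rtrancl_height[OF trancl_into_rtrancl])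
    then have "(i, j) \<in> toric_trancl Q" "h i = h j"
      using that by (auto simp: shift_def)
    then have "(i, j) \<in> Q\<^sup>+" "(j, i) \<in> Q\<^sup>+"
      using shift_trancl_const_height[of j i h Q] ji
      by (auto simp: Q'_def toric_trancl_eq[OF assms(1)])
    then show False using assms(1) by (auto simp: acyclic_def dest: trancl_trans)
  qed
  have "(i, j) \<in> shift h (toric_trancl Q)" if "(i, j) \<in> toric_trancl Q'" for i j
  proof (rule ccontr)
    assume "(i, j) \<notin> shift h (toric_trancl Q)"
    moreover have "(i, j) \<in> shift h (toric_trancl Q) \<union> (shift h (toric_trancl Q))\<inverse>"
      using shift_graph[OF height_fun_toric_trancl[OF assms]] total[of i j] that by blast
    ultimately have "(j, i) \<in> toric_trancl Q'" using one by blast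
    then have "(i, j) \<in> Q'\<^sup>+" "(j, i) \<in> Q'\<^sup>+"
      using that by (auto simp: toric_trancl_eq[OF ac])
    then show False using ac by (auto simp: acyclic_def dest: trancl_trans)
  qed
  then show ?thesis using one by (auto simp: Q'_def)
qed

text \<open>Members of the class are shifts of \<open>Q\<close>, and the closure commutes with
  shifts, so all terms of the union coincide.\<close>

lemma toric_closure_toric_class:
  fixes Q :: "'n::finite rel"
  assumes "acyclic Q"
  shows "toric_closure (toric_class Q) = toric_class (toric_trancl Q)"
proof -
  have "toric_class (toric_trancl Q') = toric_class (toric_trancl Q)" if "Q' \<in> toric_class Q" for Q'
  proof -
    obtain h where h: "height_fun h Q" "Q' = shift h Q"
      by (rule toric_class_shift[OF \<open>Q' \<in> toric_class Q\<close>])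
    have "toric_trancl Q' \<in> toric_class (toric_trancl Q)"
      unfolding h(2) shift_toric_trancl[OF assms h(1), symmetric]
      by (rule shift_in_toric_class[OF acyclic_toric_trancl[OF assms]
            height_fun_toric_trancl[OF assms h(1)]])
    then show ?thesis by (rule toric_class_eq)
  qed
  then have "toric_closure (toric_class Q) = (\<Union>Q'\<in>toric_class Q. toric_class (toric_trancl Q))"
    unfolding toric_closure_def by (intro SUP_cong refl)
  moreover have "toric_class Q \<noteq> {}"
    using self_in_toric_class by blast
  ultimately show ?thesis by simp
qed

text \<open>A height function leading from \<open>toric_trancl Q\<close> to \<open>R'\<close> is
  also one for the subquiver \<open>Q\<close>. Hence every representative of the closed class is
  itself a closure, which gives access to the spanning arcs.\<close>

lemma toric_closure_memE:
  fixes Q :: "'n::finite rel"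
  assumes "acyclic Q" "R' \<in> toric_closure (toric_class Q)"
  obtains Q' where "Q' \<in> toric_class Q" "R' = toric_trancl Q'"
proof -
  obtain h where h: "height_fun h (toric_trancl Q)" "R' = shift h (toric_trancl Q)"
    using assms toric_closure_toric_class toric_class_shift by metis
  have "height_fun h Q"
    using h(1) toric_trancl_supset by (rule height_fun_mono)
  then show ?thesis
    using that shift_toric_trancl shift_in_toric_class assms(1) h(2) by metis
qed

lemma toric_closure_graph_iff:
  fixes Q :: "'n::finite rel"
  assumes "acyclic Q"
  shows "(i, j) \<in> underlying_graph (toric_closure (toric_class Q)) \<longleftrightarrow>
    i \<noteq> j \<and> torically_comparable (toric_class Q) i j"
  by (simp add: toric_closure_toric_class[OF assms] underlying_graph_toric_class
      toric_trancl_total_iff[OF assms] del: Un_iff)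

lemma closure_complete_iff:
  fixes Q :: "'n::finite rel"
  assumes "acyclic Q"
  shows "closure_complete (toric_class Q) \<longleftrightarrow> (\<forall>i j. torically_comparable (toric_class Q) i j)"
  unfolding closure_complete_def toric_closure_graph_iff[OF assms]
  by (metis torically_comparable_iff)

text \<open>A height function of \<open>Q'\<close> restricts to \<open>Q\<close>, so every member of
  [Q'] contains a member of [Q].\<close>

lemma torically_comparable_mono:
  fixes Q :: "'n::finite rel"
  assumes "acyclic Q" "Q \<subseteq> Q'" "torically_comparable (toric_class Q) i j"
  shows "torically_comparable (toric_class Q') i j"
  unfolding torically_comparable_iff
proof
  fix Q'' assume "Q'' \<in> toric_class Q'"
  then obtain h where h: "height_fun h Q'" "Q'' = shift h Q'" by (rule toric_class_shift)
  then have "shift h Q \<in> toric_class Q"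
    using shift_in_toric_class[OF assms(1)] height_fun_mono assms(2) by blast
  then show "i = j \<or> (i, j) \<in> Q''\<^sup>+ \<or> (j, i) \<in> Q''\<^sup>+"
    using assms(3) trancl_mono[OF _ shift_mono[OF assms(2), of h]] h(2)
    by (auto simp: torically_comparable_iff)
qed

section \<open>Toric total extensions\<close>

text \<open>For a distinct list of all vertices this is the orientation of the complete graph
  attached to \<open>w\<close>.\<close>

abbreviation list_rel :: "'n list \<Rightarrow> 'n rel" where
  "list_rel w \<equiv> {(i, j). precedes w i j}"

lemma sorted_wrt_iff_precedes: "sorted_wrt P w \<longleftrightarrow> (\<forall>i j. precedes w i j \<longrightarrow> P i j)"
  by (auto simp: sorted_wrt_iff_nth_less precedes_def)

section \<open>Linear orders given by lists\<close>

lemma precedes_Nil [simp]: "\<not> precedes [] i j"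
  by (simp add: precedes_def)

lemma precedes_Cons [simp]: "precedes (x # u) i j \<longleftrightarrow> i = x \<and> j \<in> set u \<or> precedes u i j"
proof
  assume "precedes (x # u) i j"
  then obtain k l where "k < l" "l < length (x # u)" "(x # u) ! k = i" "(x # u) ! l = j"
    by (auto simp: precedes_def)
  then show "i = x \<and> j \<in> set u \<or> precedes u i j"
    by (cases k; cases l) (auto simp: precedes_def)
next
  assume "i = x \<and> j \<in> set u \<or> precedes u i j"
  then show "precedes (x # u) i j"
  proof
    assume "i = x \<and> j \<in> set u"
    then obtain l where "l < length u" "u ! l = j" "i = x"
      by (auto simp: in_set_conv_nth)
    then show ?thesis
      unfolding precedes_def by (intro exI[of _ 0] exI[of _ "Suc l"]) auto
  next
    assume "precedes u i j"
    then obtain k l where "k < l" "l < length u" "u ! k = i" "u ! l = j"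
      by (auto simp: precedes_def)
    then show ?thesis
      unfolding precedes_def by (intro exI[of _ "Suc k"] exI[of _ "Suc l"]) auto
  qed
qed

lemma precedes_set: "precedes w i j \<Longrightarrow> i \<in> set w \<and> j \<in> set w"
  by (auto simp: precedes_def)

lemma precedes_append:
  "precedes (u @ v) i j \<longleftrightarrow> precedes u i j \<or> precedes v i j \<or> i \<in> set u \<and> j \<in> set v"
  by (induction u) auto

lemma precedes_asym: "distinct w \<Longrightarrow> precedes w i j \<Longrightarrow> \<not> precedes w j i"
  by (induction w) (auto dest: precedes_set)

lemma precedes_trans: "distinct w \<Longrightarrow> precedes w i j \<Longrightarrow> precedes w j k \<Longrightarrow> precedes w i k"
  by (induction w) (auto dest: precedes_set)

lemma list_rel_unique:
  assumes "distinct w" "distinct w'" "set w = set w'" "list_rel w = list_rel w'"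
  shows "w = w'"
  using assms
proof (induction w arbitrary: w')
  case (Cons x u)
  then obtain y v where w': "w' = y # v" by (cases w') auto
  have eq: "precedes (x # u) i j \<longleftrightarrow> precedes (y # v) i j" for i j
    using Cons.prems(4) unfolding w' by blast
  have "x = y"
  proof (rule ccontr)
    assume "x \<noteq> y"
    then have "y \<in> set u" "x \<in> set v" using Cons.prems(3) w' by auto
    then have "precedes (x # u) x y" "precedes (x # u) y x" using eq by auto
    then show False using precedes_asym[OF Cons.prems(1)] by blast
  qed
  moreover have "set u = set v"
    using Cons.prems(1-3) w' \<open>x = y\<close> by auto
  moreover have "precedes u i j \<longleftrightarrow> precedes v i j" for i j
    using eq[of i j] Cons.prems(1,2) precedes_set[of u i j] precedes_set[of v i j] w' \<open>x = y\<close> by auto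
  ultimately show ?case
    using Cons.IH[of v] Cons.prems(1,2) w' by auto
qed simp

lemma topological_sort:
  fixes r :: "'n::finite rel"
  assumes "acyclic r"
  shows "\<exists>w. distinct w \<and> set w = UNIV \<and> r \<subseteq> list_rel w"
proof -
  have "\<exists>w. distinct w \<and> set w = A \<and> r \<inter> A \<times> A \<subseteq> list_rel w" for A :: "'n set"
  proof (induction "card A" arbitrary: A)
    case 0
    then show ?case by (intro exI[of _ "[]"]) auto
  next
    case (Suc c)
    then obtain a where "a \<in> A" by (metis card.empty equals0I nat.distinct(1))
    moreover have "wf r" using assms by (simp add: finite_acyclic_wf)
    ultimately obtain z where z: "z \<in> A" "\<And>y. (y, z) \<in> r \<Longrightarrow> y \<notin> A"
      using wfE_min by metis
    have "c = card (A - {z})" using Suc.hyps(2) z(1) by simp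
    then obtain u where u: "distinct u" "set u = A - {z}"
      "r \<inter> (A - {z}) \<times> (A - {z}) \<subseteq> list_rel u"
      using Suc.hyps(1) by blast
    have "r \<inter> A \<times> A \<subseteq> list_rel (z # u)"
      using u z by auto
    then show ?case
      using u z by (intro exI[of _ "z # u"]) auto
  qed
  from this[of UNIV] show ?thesis by simp
qed

section \<open>Rotations of a list and flips at its first entry\<close>

lemma rotation_class_rotate1: "rotation_class (rotate1 w) = rotation_class w"
proof (cases "w = []")
  case False
  \<comment> \<open>Rotating by \<open>length w - 1\<close> further places undoes
    \<open>rotate1\<close>; this keeps the amount of rotation a natural number.\<close>
  have "rotate k w = rotate (k + (length w - 1)) (rotate1 w)" for k
  proof -
    have "rotate (k + (length w - 1)) (rotate1 w) = rotate (Suc (k + (length w - 1))) w"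
      by (simp add: rotate1_rotate_swap)
    also have "Suc (k + (length w - 1)) = k + length w"
      using False by (cases w) auto
    also have "rotate (k + length w) w = rotate k w"
      by (subst (1 2) rotate_conv_mod) simp
    finally show ?thesis by simp
  qed
  moreover have "rotate k (rotate1 w) = rotate (Suc k) w" for k
    by (simp add: rotate1_rotate_swap)
  ultimately show ?thesis
    unfolding rotation_class_def by blast
qed (simp add: rotation_class_def)

lemma rotation_class_rotate: "rotation_class (rotate k w) = rotation_class w"
  by (induction k) (simp_all add: rotation_class_rotate1)

lemma rotation_class_mem_eq: "w' \<in> rotation_class w \<Longrightarrow> rotation_class w' = rotation_class w"
  by (auto simp: rotation_class_def[of w] rotation_class_rotate)

lemma self_in_rotation_class [simp]: "w \<in> rotation_class w"
  unfolding rotation_class_def using rotate0 by (metis (mono_tags, lifting) id_apply mem_Collect_eq)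

text \<open>Reduces claims about all rotations to moving the first entry to the end, which is a flip
  at a source.\<close>

lemma rotation_class_rotate1_induct [consumes 1, case_names self rotate1]:
  assumes "w' \<in> rotation_class w" "P w" "\<And>v. v \<in> rotation_class w \<Longrightarrow> P v \<Longrightarrow> P (rotate1 v)"
  shows "P w'"
proof -
  have "P (rotate k w)" for k
    using assms(2,3) by (induction k) (auto simp: rotation_class_def)
  then show ?thesis using assms(1) by (auto simp: rotation_class_def)
qed

lemma rotation_class_distinct:
  assumes "w' \<in> rotation_class w" "distinct w"
  shows "distinct w'" "set w' = set w"
  using assms by (auto simp: rotation_class_def)

lemma flip_list_rel_rotate1:
  assumes "distinct (x # u)" "set (x # u) = UNIV" "Q \<subseteq> list_rel (x # u)"
  shows "is_source x Q" "flip x Q \<subseteq> list_rel (u @ [x])"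
proof -
  show "is_source x Q"
    using assms precedes_set[of u _ x] by (fastforce simp: is_source_def)
  then show "flip x Q \<subseteq> list_rel (u @ [x])"
    using assms by (auto simp: flip_def is_source_def precedes_append)
qed

lemma flip_list_rel:
  assumes "distinct (x # u)"
  shows "flip x (list_rel (x # u)) = list_rel (u @ [x])" "flip x (list_rel (u @ [x])) = list_rel (x # u)"
  using assms by (auto simp: flip_def precedes_append dest: precedes_set)

text \<open>Phrased with height functions, since steps A and B construct and compare these;
  \<open>extends_iff_toric_class\<close> translates to members of the class.\<close>

definition extends :: "'n list \<Rightarrow> 'n rel \<Rightarrow> bool" where
  "extends w Q \<longleftrightarrow> (\<exists>h. height_fun h Q \<and> shift h Q \<subseteq> list_rel w)"

lemma extends_iff_toric_class:
  fixes Q :: "'n::finite rel"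
  assumes "acyclic Q"
  shows "extends w Q \<longleftrightarrow> (\<exists>Q'\<in>toric_class Q. Q' \<subseteq> list_rel w)"
  unfolding extends_def using assms shift_in_toric_class toric_class_shift by metis

text \<open>The first entry of the list is a source of any quiver contained in its order. Flipping
  it there stays in the class and matches the rotated list.\<close>

lemma extends_rotate:
  fixes Q :: "'n::finite rel"
  assumes "acyclic Q" "distinct w" "set w = UNIV" "extends w Q" "w' \<in> rotation_class w"
  shows "extends w' Q"
  using assms(5)
proof (induction rule: rotation_class_rotate1_induct)
  case self
  show ?case by (rule assms(4))
next
  case (rotate1 v)
  have v: "distinct v" "set v = UNIV"
    using rotation_class_distinct[OF rotate1.hyps assms(2)] assms(3) by auto
  then obtain x u where xu: "v = x # u" by (cases v) auto
  obtain Q' where Q': "Q' \<in> toric_class Q" "Q' \<subseteq> list_rel v"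
    using rotate1.IH unfolding extends_iff_toric_class[OF assms(1)] by blast
  have "flip x Q' \<subseteq> list_rel (rotate1 v)" "is_source x Q'"
    using flip_list_rel_rotate1[of x u Q'] v Q'(2) unfolding xu by auto
  moreover from this have "flip x Q' \<in> toric_class Q"
    using flip_in_toric_class toric_class_eq[OF Q'(1)] by metis
  ultimately show ?case
    using extends_iff_toric_class[OF assms(1)] by blast
qed

lemma sublist_rel_orientation:
  assumes "distinct w" "set w = UNIV" "Q' \<union> Q'\<inverse> = G" "irrefl G"
  shows "Q' \<subseteq> list_rel w \<longleftrightarrow> G \<inter> list_rel w = Q'"
proof
  assume "Q' \<subseteq> list_rel w"
  then show "G \<inter> list_rel w = Q'"
    using precedes_asym[OF assms(1)] assms(3) by blast
qed auto

lemma irrefl_graph: "acyclic Q \<Longrightarrow> irrefl (Q \<union> Q\<inverse>)"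
  by (auto simp: acyclic_def irrefl_def)

lemma toric_class_graph:
  assumes "Q' \<in> toric_class Q"
  shows "Q' \<union> Q'\<inverse> = Q \<union> Q\<inverse>"
  using assms toric_class_shift shift_graph by metis

section \<open>Containment of chambers as a combinatorial condition\<close>

lemma torus_proj_in_torus: "torus_proj x \<in> torus"
  by (auto simp: torus_proj_def torus_def quotient_def)

text \<open>A point whose coordinates increase along a list \<open>w'\<close> induces the
  orientation \<open>G \<inter> list_rel w'\<close>, whatever the actual values. So containment of
  chambers only asks whether these orientations lie in [Q]: \<open>extends_rotate\<close> covers all
  rotations in one direction, and a single sample point suffices in the other.\<close>

lemma total_extension_iff:
  fixes Q :: "'n::finite rel"
  assumes "acyclic Q" "distinct w" "set w = UNIV"
  shows "rotation_class w \<in> toric_total_extensions (toric_class Q) \<longleftrightarrow> extends w Q"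
proof -
  define G where "G = Q \<union> Q\<inverse>"
  have irr: "irrefl G" unfolding G_def using assms(1) by (rule irrefl_graph)
  have ug: "underlying_graph (toric_class Q) = G"
    by (simp add: G_def underlying_graph_toric_class)
  have orient: "point_orientation G p = G \<inter> list_rel w'"
    if "sorted_wrt (\<lambda>i j. torus_coord p i < torus_coord p j) w'" "set w' = UNIV" for p w'
  proof -
    have lt: "torus_coord p i < torus_coord p j" if "precedes w' i j" for i j
      using \<open>sorted_wrt _ _\<close> that by (simp add: sorted_wrt_iff_precedes)
    have "torus_coord p i < torus_coord p j \<longleftrightarrow> precedes w' i j" for i j
      using lt[of i j] lt[of j i] precedes_total[of i w' j] \<open>set w' = UNIV\<close>
      by (cases "i = j") fastforce+
    then show ?thesis by (auto simp: point_orientation_def)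
  qed
  show ?thesis
  proof
    assume "extends w Q"
    have "p \<in> toric_chamber (toric_class Q)" if p: "p \<in> total_order_chamber (rotation_class w)" for p
    proof -
      obtain w' where w': "w' \<in> rotation_class w"
        "sorted_wrt (\<lambda>i j. torus_coord p i < torus_coord p j) w'"
        and inj: "inj (torus_coord p)" and "p \<in> torus"
        using p by (auto simp: total_order_chamber_def)
      have dw': "distinct w'" "set w' = UNIV"
        using rotation_class_distinct[OF w'(1) assms(2)] assms(3) by auto
      obtain Q' where Q': "Q' \<in> toric_class Q" "Q' \<subseteq> list_rel w'"
        using extends_rotate[OF assms \<open>extends w Q\<close> w'(1)]
        unfolding extends_iff_toric_class[OF assms(1)] by blast
      have "Q' \<union> Q'\<inverse> = G"
        unfolding G_def using Q'(1) by (rule toric_class_graph)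
      then have "G \<inter> list_rel w' = Q'"
        using sublist_rel_orientation[OF dw' _ irr] Q'(2) by simp
      then have "point_orientation G p \<in> toric_class Q"
        using orient[OF w'(2) dw'(2)] Q'(1) by simp
      moreover have "p \<notin> toric_arrangement G"
      proof
        assume "p \<in> toric_arrangement G"
        then obtain x i j where "(i, j) \<in> G" "p = torus_proj x" "x $ i = x $ j"
          by (auto simp: toric_arrangement_def)
        then have "torus_coord p i = torus_coord p j" "i \<noteq> j"
          using irr by (auto simp: torus_coord_proj irrefl_def)
        then show False using inj by (auto dest: injD)
      qed
      ultimately show ?thesis
        using \<open>p \<in> torus\<close> by (simp add: toric_chamber_def ug)
    qed
    then show "rotation_class w \<in> toric_total_extensions (toric_class Q)"
      using assms by (auto simp: toric_total_extensions_def toric_total_order_def)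
  next
    assume "rotation_class w \<in> toric_total_extensions (toric_class Q)"
    then have sub: "total_order_chamber (rotation_class w) \<subseteq> toric_chamber (toric_class Q)"
      by (simp add: toric_total_extensions_def)
    \<comment> \<open>The sample point spaces the entries of \<open>w\<close> evenly: index
      \<open>k\<close> gets the coordinate \<open>k / length w\<close>. These values lie in [0, 1),
      so passing to fractional parts changes nothing.\<close>
    define pos where "pos i = (THE k. k < length w \<and> w ! k = i)" for i
    have pos: "pos (w ! k) = k" if "k < length w" for k
      unfolding pos_def using assms(2) that by (auto simp: nth_eq_iff_index_eq)
    define x :: "real ^ 'n" where "x = (\<chi> i. real (pos i) / real (length w))"
    define p where "p = torus_proj x"
    have coord: "torus_coord p (w ! k) = real k / real (length w)" if "k < length w" for k
    proof -
      have "real k / real (length w) < 1"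
        using that by (auto simp: divide_less_eq_1)
      then show ?thesis
        using that by (simp add: p_def torus_coord_proj x_def pos frac_eq)
    qed
    have sorted: "sorted_wrt (\<lambda>i j. torus_coord p i < torus_coord p j) w"
      by (auto simp: sorted_wrt_iff_nth_less coord intro!: divide_strict_right_mono)
    have "inj (torus_coord p)"
    proof (rule injI)
      fix i j assume eq: "torus_coord p i = torus_coord p j"
      obtain k l where "k < length w" "w ! k = i" "l < length w" "w ! l = j"
        using assms(3) by (metis UNIV_I in_set_conv_nth)
      moreover from this have "real k / real (length w) = real l / real (length w)"
        using eq coord[of k] coord[of l] by simp
      ultimately show "i = j"
        by auto
    qed
    then have "p \<in> total_order_chamber (rotation_class w)"
      using sorted torus_proj_in_torus self_in_rotation_class[of w]
      unfolding total_order_chamber_def p_def by blast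
    then have "point_orientation G p \<in> toric_class Q"
      using sub by (auto simp: toric_chamber_def ug)
    then have "G \<inter> list_rel w \<in> toric_class Q"
      using orient[OF sorted assms(3)] by simp
    then show "extends w Q"
      unfolding extends_iff_toric_class[OF assms(1)] by (rule bexI[rotated]) simp
  qed
qed

lemma toric_total_extensionsE:
  assumes "W \<in> toric_total_extensions P"
  obtains w where "distinct w" "set w = UNIV" "W = rotation_class w"
  using assms unfolding toric_total_extensions_def toric_total_order_def by blast

section \<open>Extensions under adding arcs and under closure\<close>

lemma total_extensions_subset:
  fixes Q Q' :: "'n::finite rel"
  assumes "acyclic Q" "acyclic Q'"
    and "\<And>w. distinct w \<Longrightarrow> set w = UNIV \<Longrightarrow> extends w Q \<Longrightarrow> extends w Q'"
  shows "toric_total_extensions (toric_class Q) \<subseteq> toric_total_extensions (toric_class Q')"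
proof
  fix W assume W: "W \<in> toric_total_extensions (toric_class Q)"
  then obtain w where "distinct w" "set w = UNIV" "W = rotation_class w"
    by (rule toric_total_extensionsE)
  then show "W \<in> toric_total_extensions (toric_class Q')"
    using W assms total_extension_iff by metis
qed

lemma total_extensions_antimono:
  fixes Q Q' :: "'n::finite rel"
  assumes "acyclic Q'" "Q \<subseteq> Q'"
  shows "toric_total_extensions (toric_class Q') \<subseteq> toric_total_extensions (toric_class Q)"
proof (rule total_extensions_subset)
  show "acyclic Q" using assms by (rule acyclic_subset)
  show "extends w Q" if "extends w Q'" for w
    using that height_fun_mono[OF _ assms(2)] subset_trans[OF shift_mono[OF assms(2)]]
    unfolding extends_def by blast
qed (rule assms)

text \<open>The order of \<open>w\<close> is transitive, so together with a shift of
  \<open>Q\<close> it contains the paths of that shift and hence its closure, which is the same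
  shift of \<open>toric_trancl Q\<close>.\<close>

lemma total_extensions_toric_trancl:
  fixes Q :: "'n::finite rel"
  assumes "acyclic Q"
  shows "toric_total_extensions (toric_class (toric_trancl Q)) = toric_total_extensions (toric_class Q)"
proof
  show "toric_total_extensions (toric_class (toric_trancl Q)) \<subseteq> toric_total_extensions (toric_class Q)"
    using acyclic_toric_trancl[OF assms] toric_trancl_supset by (rule total_extensions_antimono)
  show "toric_total_extensions (toric_class Q) \<subseteq> toric_total_extensions (toric_class (toric_trancl Q))"
  proof (rule total_extensions_subset[OF assms acyclic_toric_trancl[OF assms]])
    fix w :: "'n list" assume w: "distinct w" "set w = UNIV" "extends w Q"
    then obtain h where h: "height_fun h Q" "shift h Q \<subseteq> list_rel w"
      by (auto simp: extends_def)
    have "trans (list_rel w)"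
      using precedes_trans[OF w(1)] by (auto simp: trans_def)
    then have "(shift h Q)\<^sup>+ \<subseteq> list_rel w"
      using trancl_mono_subset[OF h(2)] by simp
    then have "toric_trancl (shift h Q) \<subseteq> list_rel w"
      by (auto simp: toric_trancl_eq[OF acyclic_shift[OF assms]])
    then show "extends w (toric_trancl Q)"
      unfolding extends_def shift_toric_trancl[OF assms h(1), symmetric]
      using height_fun_toric_trancl[OF assms h(1)] by blast
  qed
qed

section \<open>The two steps\<close>

lemma condition_A_acyclic:
  fixes R :: "'n::finite rel"
  assumes "acyclic R" "condition_A (toric_class R) a b"
  shows "acyclic (add_arc R a b)"
proof -
  have "(R \<union> R\<inverse>)\<^sup>* = ((R \<union> R\<inverse>)\<^sup>*)\<inverse>"
    by (metis converse_Un converse_converse rtrancl_converse sup_commute)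
  moreover have "R\<^sup>* \<subseteq> (R \<union> R\<inverse>)\<^sup>*"
    by (rule rtrancl_mono) simp
  ultimately have "(b, a) \<notin> R\<^sup>*"
    using assms(2) unfolding condition_A_def underlying_graph_toric_class by blast
  then show ?thesis
    using assms(1) by (simp add: add_arc_def)
qed

text \<open>Criterion shared by both steps: equal heights keep the new arc, a growth of one reverses
  it, and the outcome has to point forward in \<open>w\<close>.\<close>

lemma extends_add_arcI:
  assumes "height_fun h Q" "shift h Q \<subseteq> list_rel w"
    and "h b = h a \<and> precedes w a b \<or> h b = h a + 1 \<and> precedes w b a"
  shows "extends w (add_arc Q a b)"
  unfolding extends_def
proof (intro exI conjI)
  show "height_fun h (add_arc Q a b)"
    using assms(1,3) unfolding height_fun_add_arc by blast
  show "shift h (add_arc Q a b) \<subseteq> list_rel w"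
    using assms(2,3) unfolding shift_add_arc by (elim disjE conjE) simp_all
qed

text \<open>No arc of \<open>R\<close> leaves the component \<open>K\<close> of \<open>a\<close>, so
  adding a constant to the heights outside \<open>K\<close> does not affect
  \<open>shift h R\<close>. The constant is chosen to make the height difference from
  \<open>a\<close> to \<open>b\<close> the one that \<open>w\<close> demands.\<close>

lemma total_extensions_step_A:
  fixes R :: "'n::finite rel"
  assumes "acyclic R" "condition_A (toric_class R) a b"
  shows "toric_total_extensions (toric_class R) = toric_total_extensions (toric_class (add_arc R a b))"
proof
  note ac = condition_A_acyclic[OF assms]
  show "toric_total_extensions (toric_class (add_arc R a b)) \<subseteq> toric_total_extensions (toric_class R)"
    using ac by (rule total_extensions_antimono) (auto simp: add_arc_def)
  show "toric_total_extensions (toric_class R) \<subseteq> toric_total_extensions (toric_class (add_arc R a b))"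
  proof (rule total_extensions_subset[OF assms(1) ac])
    fix w :: "'n list" assume w: "distinct w" "set w = UNIV" "extends w R"
    then obtain h where h: "height_fun h R" "shift h R \<subseteq> list_rel w"
      by (auto simp: extends_def)
    define K where "K = {x. (a, x) \<in> (R \<union> R\<inverse>)\<^sup>*}"
    have K: "x \<in> K \<longleftrightarrow> y \<in> K" if "(x, y) \<in> R" for x y
      unfolding K_def using that by (auto intro: rtrancl_into_rtrancl)
    have ab: "a \<in> K" "b \<notin> K" "a \<noteq> b"
      using assms(2) by (auto simp: K_def condition_A_def underlying_graph_toric_class)
    \<comment> \<open>Shift the component of \<open>b\<close> so that the new arc is oriented as in \<open>w\<close>.\<close>
    define c where "c = h a - h b + (if precedes w a b then 0 else 1)"
    define h' where "h' x = (if x \<in> K then h x else h x + c)" for x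
    have diff: "h' y - h' x = h y - h x" if "(x, y) \<in> R" for x y
      using K[OF that] by (simp add: h'_def)
    have step: "h' y = h' x \<longleftrightarrow> h y = h x" "h' y = h' x + 1 \<longleftrightarrow> h y = h x + 1"
      if "(x, y) \<in> R" for x y
      using diff[OF that] by linarith+
    have h': "height_fun h' R"
      using h(1) step unfolding height_fun_def by blast
    have "shift h' R = shift h R"
      using step unfolding shift_def by blast
    then have sub: "shift h' R \<subseteq> list_rel w"
      using h(2) by simp
    have "h' a = h a" "h' b = h a + (if precedes w a b then 0 else 1)"
      using ab by (auto simp: h'_def c_def)
    moreover have "precedes w a b \<or> precedes w b a"
      using precedes_total[of a w b] ab(3) w(2) by simp
    ultimately have "h' b = h' a \<and> precedes w a b \<or> h' b = h' a + 1 \<and> precedes w b a"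
      by (cases "precedes w a b") simp_all
    then show "extends w (add_arc R a b)"
      by (rule extends_add_arcI[OF h' sub])
  qed
qed

section \<open>Step B\<close>

lemma condition_B_arcs:
  fixes R :: "'n::finite rel"
  assumes "acyclic R" "condition_B (toric_class R) a b v"
    and "R' \<in> toric_closure (toric_class R)" "is_source v R'"
  shows "(v, a) \<in> R'" "(v, b) \<in> R'" "a \<noteq> b"
proof -
  have "R' \<in> toric_class (toric_trancl R)"
    using assms(3) by (simp add: toric_closure_toric_class[OF assms(1)])
  then have "underlying_graph (toric_closure (toric_class R)) = R' \<union> R'\<inverse>"
    by (simp add: toric_closure_toric_class[OF assms(1)] underlying_graph_toric_class toric_class_graph)
  then show "(v, a) \<in> R'" "(v, b) \<in> R'"
    using assms(2,4) by (auto simp: condition_B_def is_source_def)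
  show "a \<noteq> b"
    using assms(2) by (auto simp: condition_B_def at_distance_def dest: spec[of _ 0])
qed

text \<open>Lets the branch with b -> a reuse the facts about a -> b.\<close>

lemma condition_B_sym:
  assumes "condition_B (toric_class R) a b v"
  shows "condition_B (toric_class R) b a v"
proof -
  let ?G = "underlying_graph (toric_closure (toric_class R))"
  have sym: "(x, y) \<in> ?G \<Longrightarrow> (y, x) \<in> ?G" for x y
    by (auto simp: underlying_graph_def)
  have *: "(x, y) \<in> ?G ^^ k \<Longrightarrow> (y, x) \<in> ?G ^^ k" for x y k
  proof (induction k arbitrary: y)
    case (Suc k)
    then obtain z where "(x, z) \<in> ?G ^^ k" "(z, y) \<in> ?G" by auto
    then show ?case using relpow_Suc_I2[OF sym Suc.IH] by blast
  qed simp
  have "(x, y) \<in> ?G ^^ k \<longleftrightarrow> (y, x) \<in> ?G ^^ k" for x y k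
    using *[of x y k] *[of y x k] by blast
  then show ?thesis
    using assms torically_comparable_sym[of "toric_class R" a b]
    unfolding condition_B_def at_distance_def by blast
qed

text \<open>A path from \<open>b\<close> to \<open>a\<close> would put \<open>b\<close> between
  \<open>v\<close> and \<open>a\<close>. The arc of \<open>Q\<close> spanning \<open>v\<close> and
  \<open>a\<close> would then span \<open>b\<close> and \<open>a\<close> too and make them
  comparable.\<close>

lemma condition_B_acyclic:
  fixes R :: "'n::finite rel"
  assumes "acyclic R" "condition_B (toric_class R) a b v"
    and "R' \<in> toric_closure (toric_class R)" "is_source v R'"
  shows "acyclic (add_arc R' a b)"
proof -
  note arcs = condition_B_arcs[OF assms]
  obtain Q where Q: "Q \<in> toric_class R" "R' = toric_trancl Q"
    using toric_closure_memE[OF assms(1,3)] .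
  have acQ: "acyclic Q" using assms(1) Q(1) by (rule acyclic_toric_class)
  have sub: "R' \<subseteq> Q\<^sup>+" "\<And>i j. (i, j) \<in> R' \<Longrightarrow> torically_comparable (toric_class Q) i j"
    unfolding Q(2) toric_trancl_eq[OF acQ] by auto
  have "(b, a) \<notin> R'\<^sup>*"
  proof
    assume "(b, a) \<in> R'\<^sup>*"
    then have ba: "(b, a) \<in> Q\<^sup>*"
      using rtrancl_mono[OF sub(1)] by auto
    obtain s t where st: "(s, t) \<in> Q" "(s, v) \<in> Q\<^sup>*" "(a, t) \<in> Q\<^sup>*"
      using torically_comparable_imp_spanned[OF acQ _ sub(2)[OF arcs(1)]] arcs(1) sub(1) by blast
    have "(v, b) \<in> Q\<^sup>*" using arcs(2) sub(1) by (auto dest: trancl_into_rtrancl)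
    then have "torically_comparable (toric_class Q) b a"
      using spanned_imp_torically_comparable[OF st(1) rtrancl_trans[OF st(2)] ba st(3)] by blast
    then show False
      using assms(2) toric_class_eq[OF Q(1)] torically_comparable_sym
      unfolding condition_B_def by metis
  qed
  moreover have "acyclic R'"
    unfolding Q(2) using acQ by (rule acyclic_toric_trancl)
  ultimately show ?thesis by (simp add: add_arc_def)
qed

lemma total_extensions_toric_closure:
  fixes R :: "'n::finite rel"
  assumes "acyclic R" "R' \<in> toric_closure (toric_class R)"
  shows "toric_total_extensions (toric_class R') = toric_total_extensions (toric_class R)"
proof -
  have "toric_class R' = toric_class (toric_trancl R)"
    using assms(2) by (simp add: toric_closure_toric_class[OF assms(1)] toric_class_eq)
  then show ?thesis
    by (simp add: total_extensions_toric_trancl[OF assms(1)])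
qed

text \<open>Because of the arcs v -> a and v -> b, the order \<open>w\<close> determines the heights
  of \<open>a\<close> and \<open>b\<close> relative to \<open>v\<close>: 0 for a vertex after
  \<open>v\<close>, 1 for a vertex before it. Both the covering and the disjointness are read off
  from this.\<close>

lemma total_extensions_step_B:
  fixes R :: "'n::finite rel"
  assumes "acyclic R" "condition_B (toric_class R) a b v"
    and "R' \<in> toric_closure (toric_class R)" "is_source v R'"
  shows "toric_total_extensions (toric_class R) =
           toric_total_extensions (toric_class (add_arc R' a b)) \<union>
           toric_total_extensions (toric_class (add_arc R' b a))"
    and "toric_total_extensions (toric_class (add_arc R' a b)) \<inter>
           toric_total_extensions (toric_class (add_arc R' b a)) = {}"
proof -
  note arcs = condition_B_arcs[OF assms]
  have ac: "acyclic (add_arc R' a b)" "acyclic (add_arc R' b a)"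
    by (rule condition_B_acyclic[OF assms],
        rule condition_B_acyclic[OF assms(1) condition_B_sym[OF assms(2)] assms(3,4)])
  have acR': "acyclic R'"
    using ac(1) by (rule acyclic_subset) (auto simp: add_arc_def)
  have incl: "toric_total_extensions (toric_class (add_arc R' a b)) \<subseteq> toric_total_extensions (toric_class R')"
    "toric_total_extensions (toric_class (add_arc R' b a)) \<subseteq> toric_total_extensions (toric_class R')"
    by (rule total_extensions_antimono[OF ac(1)], force simp: add_arc_def,
        rule total_extensions_antimono[OF ac(2)], force simp: add_arc_def)
  show "toric_total_extensions (toric_class R) =
           toric_total_extensions (toric_class (add_arc R' a b)) \<union>
           toric_total_extensions (toric_class (add_arc R' b a))"
    unfolding total_extensions_toric_closure[OF assms(1,3), symmetric]
  proof (intro subset_antisym Un_least incl subsetI)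
    fix W assume W: "W \<in> toric_total_extensions (toric_class R')"
    then obtain w where w: "distinct w" "set w = UNIV" "W = rotation_class w"
      by (rule toric_total_extensionsE)
    then have "extends w R'"
      using W total_extension_iff[OF acR'] by simp
    then obtain h where h: "height_fun h R'" "shift h R' \<subseteq> list_rel w"
      by (auto simp: extends_def)
    have shifts: "(v, x) \<in> shift h R' \<and> h x = h v \<or> (x, v) \<in> shift h R' \<and> h x = h v + 1"
      if "(v, x) \<in> R'" for x
      using height_funD[OF h(1) that] that by (auto simp: shift_def)
    have prec: "precedes w v x \<and> h x = h v \<or> precedes w x v \<and> h x = h v + 1"
      if "(v, x) \<in> R'" for x
      using shifts[OF that] h(2) by auto
    note va = prec[OF arcs(1)] and vb = prec[OF arcs(2)]
    have tot: "precedes w a b \<or> precedes w b a"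
      using precedes_total[of a w b] arcs(3) w(2) by simp
    have "extends w (add_arc R' a b) \<or> extends w (add_arc R' b a)"
    proof -
      have "h a = h v \<or> h a = h v + 1" "h b = h v \<or> h b = h v + 1"
        using va vb by blast+
      \<comment> \<open>At equal heights the arc is added in the direction of \<open>w\<close>.
        Otherwise \<open>v\<close> lies between \<open>a\<close> and \<open>b\<close> in
        \<open>w\<close>, with the higher vertex first; the arc from the lower to the higher vertex
        is added and gets reversed, as \<open>w\<close> demands.\<close>
      then consider "h a = h b" | "h a = h v" "h b = h v + 1" | "h a = h v + 1" "h b = h v"
        by auto
      then show ?thesis
      proof cases
        case 1
        then show ?thesis
          using tot extends_add_arcI[OF h, of b a] extends_add_arcI[OF h, of a b] by metis
      next
        case 2
        then have "precedes w b v" "precedes w v a"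
          using va vb by simp_all
        then have "precedes w b a"
          by (rule precedes_trans[OF w(1)])
        then show ?thesis
          using 2 extends_add_arcI[OF h, of b a] by simp
      next
        case 3
        then have "precedes w a v" "precedes w v b"
          using va vb by simp_all
        then have "precedes w a b"
          by (rule precedes_trans[OF w(1)])
        then show ?thesis
          using 3 extends_add_arcI[OF h, of a b] by simp
      qed
    qed
    then show "W \<in> toric_total_extensions (toric_class (add_arc R' a b)) \<union>
        toric_total_extensions (toric_class (add_arc R' b a))"
      using total_extension_iff[OF ac(1) w(1,2)] total_extension_iff[OF ac(2) w(1,2)] w(3) by simp
  qed
  show "toric_total_extensions (toric_class (add_arc R' a b)) \<inter>
           toric_total_extensions (toric_class (add_arc R' b a)) = {}"
  proof (rule equals0I, elim IntE)
    fix W assume W1: "W \<in> toric_total_extensions (toric_class (add_arc R' a b))"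
      and W2: "W \<in> toric_total_extensions (toric_class (add_arc R' b a))"
    obtain w where w: "distinct w" "set w = UNIV" "W = rotation_class w"
      by (rule toric_total_extensionsE[OF W1])
    have "extends w (add_arc R' a b)" "extends w (add_arc R' b a)"
      using W1 W2 w(3) total_extension_iff[OF ac(1) w(1,2)] total_extension_iff[OF ac(2) w(1,2)]
      by simp_all
    then obtain h1 h2 where h1: "height_fun h1 (add_arc R' a b)" "shift h1 (add_arc R' a b) \<subseteq> list_rel w"
      and h2: "height_fun h2 (add_arc R' b a)" "shift h2 (add_arc R' b a) \<subseteq> list_rel w"
      unfolding extends_def by blast
    have prec: "precedes w v x \<and> h x = h v \<or> precedes w x v \<and> h x = h v + 1"
      if "(v, x) \<in> R'" "height_fun h R'" "shift h R' \<subseteq> list_rel w" for h x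
      using height_funD[OF that(2,1)] that(1,3) by (auto simp: shift_def)
    have sub: "height_fun h1 R'" "shift h1 R' \<subseteq> list_rel w" "height_fun h2 R'" "shift h2 R' \<subseteq> list_rel w"
      using h1 h2 by (simp_all add: height_fun_add_arc shift_add_arc)
    \<comment> \<open>The height of \<open>x\<close> above \<open>v\<close> depends only on whether
      \<open>w\<close> puts \<open>x\<close> after or before \<open>v\<close>, so the two height
      functions agree on it.\<close>
    have *: "h1 x - h1 v = h2 x - h2 v" if "(v, x) \<in> R'" for x
    proof (cases "precedes w v x")
      case True
      then show ?thesis
        using prec[OF that sub(1,2)] prec[OF that sub(3,4)] precedes_asym[OF w(1) True] by simp
    next
      case False
      then show ?thesis
        using prec[OF that sub(1,2)] prec[OF that sub(3,4)] by simp
    qed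
    then have "h1 b - h1 a = h2 b - h2 a"
      using *[OF arcs(1)] *[OF arcs(2)] by linarith
    \<comment> \<open>The arc a -> b allows a difference of 0 or 1 from \<open>a\<close> to
      \<open>b\<close>, and the arc b -> a allows 0 or -1. The common value is 0, so both arcs are
      kept and contradict each other in \<open>w\<close>.\<close>
    then have "h1 a = h1 b" "h2 a = h2 b"
      using h1(1) h2(1) by (auto simp: height_fun_add_arc)
    then have "precedes w a b" "precedes w b a"
      using h1(2) h2(2) by (auto simp: shift_add_arc)
    then show False using precedes_asym[OF w(1)] by blast
  qed
qed

section \<open>Existence of an applicable step\<close>

lemma relpow_two_iff: "(x, y) \<in> G ^^ 2 \<longleftrightarrow> (\<exists>z. (x, z) \<in> G \<and> (z, y) \<in> G)"
  by (auto simp: numeral_2_eq_2)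

text \<open>Without pairs at distance two, two consecutive edges always lead back or to a neighbour,
  so connected distinct vertices would be adjacent.\<close>

lemma exists_at_distance_two:
  assumes "(a, b) \<in> G\<^sup>*" "a \<noteq> b" "(a, b) \<notin> G"
  shows "\<exists>c d v. at_distance G 2 c d \<and> (c, v) \<in> G \<and> (v, d) \<in> G"
proof (rule ccontr)
  assume none: "\<nexists>c d v. at_distance G 2 c d \<and> (c, v) \<in> G \<and> (v, d) \<in> G"
  have tr: "(x, z) \<in> G \<or> x = z" if "(x, y) \<in> G" "(y, z) \<in> G" for x y z
  proof (rule ccontr)
    assume "\<not> ?thesis"
    then have "at_distance G 2 x z"
      using that by (auto simp: at_distance_def relpow_two_iff less_2_cases_iff)
    then show False using none that by blast
  qed
  have "(a, b) \<in> G \<or> a = b"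
    using assms(1)
  proof induction
    case (step y z)
    then show ?case using tr by blast
  qed simp
  then show False using assms by blast
qed

text \<open>An incomparable pair in different components allows step A. A connected one is connected
  but not adjacent in the comparability graph, so that graph has some pair at distance two, possibly
  another one, for step B.\<close>

lemma condition_exists:
  fixes R :: "'n::finite rel"
  assumes "acyclic R" "\<not> closure_complete (toric_class R)"
  shows "(\<exists>a b. condition_A (toric_class R) a b) \<or> (\<exists>a b v. condition_B (toric_class R) a b v)"
proof -
  define H where "H = underlying_graph (toric_closure (toric_class R))"
  obtain a b where ab: "\<not> torically_comparable (toric_class R) a b"
    using assms closure_complete_iff by blast
  have H: "(i, j) \<in> H \<longleftrightarrow> i \<noteq> j \<and> torically_comparable (toric_class R) i j" for i j
    unfolding H_def by (rule toric_closure_graph_iff[OF assms(1)])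
  have "a \<noteq> b" using ab by (auto simp: torically_comparable_iff)
  show ?thesis
  proof (cases "(a, b) \<in> (R \<union> R\<inverse>)\<^sup>*")
    case False
    then show ?thesis
      using ab by (auto simp: condition_A_def underlying_graph_toric_class)
  next
    case True
    have "R \<union> R\<inverse> \<subseteq> H"
    proof (rule subrelI)
      fix i j assume ij: "(i, j) \<in> R \<union> R\<inverse>"
      then have "i \<noteq> j" using irrefl_graph[OF assms(1)] by (auto simp: irrefl_def)
      then show "(i, j) \<in> H" using H arc_imp_torically_comparable[OF ij] by blast
    qed
    then have "(a, b) \<in> H\<^sup>*" using True rtrancl_mono by blast
    then obtain c d v where cd: "at_distance H 2 c d" "(c, v) \<in> H" "(v, d) \<in> H"
      using exists_at_distance_two[of a b H] \<open>a \<noteq> b\<close> ab H by blast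
    have "\<forall>k<2. (c, d) \<notin> H ^^ k"
      using cd(1) by (simp add: at_distance_def)
    from this[rule_format, of 0] this[rule_format, of 1] have "c \<noteq> d" "(c, d) \<notin> H"
      by auto
    then have "\<not> torically_comparable (toric_class R) c d"
      using H by auto
    moreover have "(v, c) \<in> H"
      using cd(2) H torically_comparable_sym by metis
    ultimately show ?thesis
      using cd unfolding condition_B_def H_def by blast
  qed
qed

text \<open>The height function reverses the arcs leaving the strict down-set of \<open>v\<close>,
  among them all arcs into \<open>v\<close>. By acyclicity the out-neighbours of \<open>v\<close>
  have the same height as \<open>v\<close>, so its outgoing arcs stay. This supplies the
  representative required by step B.\<close>

lemma exists_source_in_class:
  fixes R :: "'n::finite rel"
  assumes "acyclic R"
  shows "\<exists>R'\<in>toric_class R. is_source v R'"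
proof -
  define h where "h x = (if (x, v) \<in> R\<^sup>+ then 0 else 1 :: int)" for x
  have "height_fun h R"
    by (auto simp: height_fun_def h_def intro: trancl_into_trancl2)
  moreover have "is_source v (shift h R)"
    using assms by (auto simp: is_source_def shift_def h_def acyclic_def split: if_splits
        intro: trancl_into_trancl2)
  ultimately show ?thesis
    using shift_in_toric_class[OF assms] by blast
qed

section \<open>Complete closures\<close>

lemma list_rel_toric_class_rotation:
  assumes "distinct w" "set w = UNIV" "w' \<in> rotation_class w"
  shows "list_rel w' \<in> toric_class (list_rel w)"
  using assms(3)
proof (induction rule: rotation_class_rotate1_induct)
  case (rotate1 v)
  have v: "distinct v" "set v = UNIV"
    using rotation_class_distinct[OF rotate1.hyps assms(1)] assms(2) by auto
  then obtain x u where xu: "v = x # u" by (cases v) auto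
  have "list_rel (rotate1 v) = flip x (list_rel v)"
    using v flip_list_rel(1)[of x u] xu by simp
  moreover have "is_source x (list_rel v)"
    using flip_list_rel_rotate1(1)[of x u "list_rel v"] v xu by blast
  ultimately show ?case
    using flip_in_toric_class toric_class_eq[OF rotate1.IH] by metis
qed simp

text \<open>In the orientation given by a list, the only source is the first entry and the only sink
  the last, so each flip is a rotation by one place.\<close>

lemma toric_class_list_rel:
  assumes "distinct w" "set w = UNIV" "Q' \<in> toric_class (list_rel w)"
  shows "\<exists>w'\<in>rotation_class w. Q' = list_rel w'"
proof -
  have "flip_step\<^sup>*\<^sup>* (list_rel w) Q'"
    using assms(3) by (simp add: toric_class_def)
  then show ?thesis
  proof induction
    case base
    show ?case using self_in_rotation_class by blast
  next
    case (step Q' Q'')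
    then obtain v where v: "v \<in> rotation_class w" "Q' = list_rel v" by blast
    have v': "distinct v" "set v = UNIV"
      using rotation_class_distinct[OF v(1) assms(1)] assms(2) by auto
    obtain k where k: "is_source k Q' \<or> is_sink k Q'" "Q'' = flip k Q'"
      using step.hyps(2) by (auto simp: flip_step_def)
    from k(1) have "\<exists>v'. Q'' = list_rel v' \<and> rotation_class v' = rotation_class v"
    proof
      assume src: "is_source k Q'"
      obtain x u where xu: "v = x # u" using v'(2) by (cases v) auto
      have "x = k"
      proof (rule ccontr)
        assume "x \<noteq> k"
        then have "precedes v x k" using v'(2) xu by auto
        then show False using src v(2) by (auto simp: is_source_def)
      qed
      then have "Q'' = list_rel (rotate1 v)"
        using flip_list_rel(1)[of x u] v' v(2) k(2) xu by simp
      then show ?thesis using rotation_class_rotate1 by blast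
    next
      assume snk: "is_sink k Q'"
      obtain x u where xu: "v = u @ [x]" using v'(2) by (cases v rule: rev_cases) auto
      have "x = k"
      proof (rule ccontr)
        assume "x \<noteq> k"
        then have "precedes v k x" using v'(2) xu by (auto simp: precedes_append)
        then show False using snk v(2) by (auto simp: is_sink_def)
      qed
      then have "Q'' = list_rel (x # u)" "v = rotate1 (x # u)"
        using flip_list_rel(2)[of x u] v' v(2) k(2) xu by simp_all
      then show ?thesis using rotation_class_rotate1 by metis
    qed
    then show ?case
      using rotation_class_mem_eq[OF v(1)] self_in_rotation_class by metis
  qed
qed

lemma poset_of_total_order_rotation_class:
  assumes "distinct w" "set w = UNIV"
  shows "poset_of_total_order (rotation_class w) = toric_class (list_rel w)"
proof -
  have "poset_of_total_order (rotation_class w) = (\<Union>w'\<in>rotation_class w. toric_class (list_rel w))"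
    unfolding poset_of_total_order_def
    by (intro SUP_cong refl toric_class_eq list_rel_toric_class_rotation[OF assms])
  moreover have "rotation_class w \<noteq> {}"
    using self_in_rotation_class by blast
  ultimately show ?thesis by simp
qed

text \<open>The closure is an acyclic orientation of the complete graph and so equals
  \<open>list_rel w\<close> for a topological sort \<open>w\<close>. Its class consists of the
  orientations of rotations of \<open>w\<close>, which leaves no other total extension.\<close>

lemma closure_complete_extensions:
  fixes R :: "'n::finite rel"
  assumes "acyclic R" "closure_complete (toric_class R)"
  shows "\<exists>W. toric_total_extensions (toric_class R) = {W} \<and> corresponds (toric_class R) W"
proof -
  define T where "T = toric_trancl R"
  have acT: "acyclic T" unfolding T_def using assms(1) by (rule acyclic_toric_trancl)
  obtain w where w: "distinct w" "set w = UNIV" "T \<subseteq> list_rel w"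
    using topological_sort[OF acT] by blast
  have total: "(i, j) \<in> T \<union> T\<inverse>" if "i \<noteq> j" for i j
    using that assms(2) unfolding T_def closure_complete_iff[OF assms(1)]
      toric_trancl_total_iff[OF assms(1)] by simp
  have "(i, j) \<in> T" if "precedes w i j" for i j
    using total[of i j] w(3) that precedes_asym[OF w(1), of i j] by blast
  then have T: "T = list_rel w"
    using w(3) by auto
  have clo: "toric_closure (toric_class R) = toric_class (list_rel w)"
    using toric_closure_toric_class[OF assms(1)] T T_def by simp
  have ext: "extends w' T \<longleftrightarrow> rotation_class w' = rotation_class w"
    if w': "distinct w'" "set w' = UNIV" for w'
  proof
    assume "extends w' T"
    then obtain w'' where w'': "w'' \<in> rotation_class w" "list_rel w'' \<subseteq> list_rel w'"
      using toric_class_list_rel[OF w(1,2)] extends_iff_toric_class[OF acT] T by blast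
    have dw'': "distinct w''" "set w'' = UNIV"
      using rotation_class_distinct[OF w''(1) w(1)] w(2) by auto
    \<comment> \<open>Both relations compare all pairs of distinct vertices, so the inclusion
      already known forces equality.\<close>
    have "list_rel w' \<subseteq> list_rel w''"
    proof (rule subrelI)
      fix i j assume "(i, j) \<in> list_rel w'"
      then have "precedes w' i j" "\<not> precedes w' j i" using precedes_asym[OF w'(1)] by auto
      then show "(i, j) \<in> list_rel w''"
        using precedes_total[of i w'' j] dw''(2) w''(2) by force
    qed
    then have "w'' = w'"
      using list_rel_unique dw'' w' w''(2) by (metis subset_antisym)
    then show "rotation_class w' = rotation_class w"
      using rotation_class_mem_eq w''(1) by blast
  next
    assume "rotation_class w' = rotation_class w"
    then have "list_rel w' \<in> toric_class T"
      using list_rel_toric_class_rotation[OF w(1,2), of w'] self_in_rotation_class[of w'] T by simp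
    then show "extends w' T"
      unfolding extends_iff_toric_class[OF acT] by blast
  qed
  have "W \<in> toric_total_extensions (toric_class T) \<longleftrightarrow> W = rotation_class w" for W
  proof
    assume W: "W \<in> toric_total_extensions (toric_class T)"
    then obtain w' where "distinct w'" "set w' = UNIV" "W = rotation_class w'"
      by (rule toric_total_extensionsE)
    then show "W = rotation_class w"
      using W total_extension_iff[OF acT] ext by blast
  next
    assume "W = rotation_class w"
    then show "W \<in> toric_total_extensions (toric_class T)"
      using total_extension_iff[OF acT w(1,2)] ext[OF w(1,2)] by blast
  qed
  then have "toric_total_extensions (toric_class R) = {rotation_class w}"
    using total_extensions_toric_trancl[OF assms(1)] unfolding T_def by blast
  moreover have "corresponds (toric_class R) (rotation_class w)"
    unfolding corresponds_def toric_total_order_def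
    using assms(2) w(1,2) clo poset_of_total_order_rotation_class[OF w(1,2)] by blast
  ultimately show ?thesis by blast
qed

section \<open>The algorithm\<close>

text \<open>A state may hold arbitrary sets of relations; this is the invariant that makes the
  lemmas on classes of acyclic quivers applicable.\<close>

definition toric_poset :: "'n rel set \<Rightarrow> bool" where
  "toric_poset P \<longleftrightarrow> (\<exists>Q. acyclic Q \<and> P = toric_class Q)"

definition incomparable_pairs :: "'n rel set \<Rightarrow> ('n \<times> 'n) set" where
  "incomparable_pairs P = {(i, j). \<not> torically_comparable P i j}"

lemma incomparable_pairs_psubset:
  fixes Q :: "'n::finite rel"
  assumes "acyclic Q" "\<not> torically_comparable (toric_class Q) a b"
  shows "incomparable_pairs (toric_class (add_arc Q a b)) \<subset> incomparable_pairs (toric_class Q)"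
proof -
  have "torically_comparable (toric_class (add_arc Q a b)) a b"
    by (rule arc_imp_torically_comparable) (simp add: add_arc_def)
  moreover have "Q \<subseteq> add_arc Q a b" by (auto simp: add_arc_def)
  ultimately show ?thesis
    using torically_comparable_mono[OF assms(1)] assms(2) unfolding incomparable_pairs_def by blast
qed

text \<open>Paths of a closure refine to paths of the quiver, so closing creates no new
  comparabilities. In step B the number of incomparable pairs can thus be counted at
  \<open>R'\<close>, where the arc is added.\<close>

lemma torically_comparable_toric_closure:
  fixes R :: "'n::finite rel"
  assumes "acyclic R" "R' \<in> toric_closure (toric_class R)"
  shows "torically_comparable (toric_class R') i j \<longleftrightarrow> torically_comparable (toric_class R) i j"
proof -
  have eq: "toric_class R' = toric_class (toric_trancl R)"
    using assms(2) by (simp add: toric_closure_toric_class[OF assms(1)] toric_class_eq)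
  show ?thesis
    unfolding eq
  proof
    assume *: "torically_comparable (toric_class (toric_trancl R)) i j"
    show "torically_comparable (toric_class R) i j"
      unfolding torically_comparable_iff
    proof
      fix Q assume Q: "Q \<in> toric_class R"
      then have acQ: "acyclic Q" by (rule acyclic_toric_class[OF assms(1)])
      have "toric_trancl Q \<in> toric_class (toric_trancl R)"
        using toric_closure_toric_class[OF assms(1)] Q self_in_toric_class
        unfolding toric_closure_def by blast
      moreover have "(toric_trancl Q)\<^sup>+ \<subseteq> Q\<^sup>+"
        using trancl_mono_subset[of "toric_trancl Q" "Q\<^sup>+"] by (auto simp: toric_trancl_eq[OF acQ])
      ultimately show "i = j \<or> (i, j) \<in> Q\<^sup>+ \<or> (j, i) \<in> Q\<^sup>+"
        using * unfolding torically_comparable_iff by blast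
    qed
  next
    assume "torically_comparable (toric_class R) i j"
    then show "torically_comparable (toric_class (toric_trancl R)) i j"
      using torically_comparable_mono[OF assms(1) toric_trancl_supset] by blast
  qed
qed

text \<open>Base 3 lets one summand outweigh the two smaller ones that replace it in step B.\<close>

definition weight :: "'n rel set multiset \<Rightarrow> nat" where
  "weight M = (\<Sum>P\<in>#M. 3 ^ card (incomparable_pairs P))"

text \<open>A sum of multisets rather than a union, so that its invariance also says that no total
  order is found twice.\<close>

definition all_extensions :: "'n::finite rel set multiset \<Rightarrow> 'n list set multiset" where
  "all_extensions M = (\<Sum>P\<in>#M. mset_set (toric_total_extensions P))"

lemma algorithm_step_invariant:
  fixes M M' :: "'n::finite rel set multiset"
  assumes "algorithm_step M M'" "\<forall>P\<in>#M. toric_poset P"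
  shows "(\<forall>P\<in>#M'. toric_poset P) \<and> weight M' < weight M \<and> all_extensions M' = all_extensions M"
  using assms
proof cases
  case (step_A P a b R N)
  have "toric_poset P" using assms(2) step_A(1) by simp
  then obtain Q where Q: "acyclic Q" "P = toric_class Q"
    unfolding toric_poset_def by blast
  then have R: "R \<in> toric_class Q" using step_A(4) by simp
  have P: "acyclic R" "P = toric_class R"
    using acyclic_toric_class[OF Q(1) R] toric_class_eq[OF R] Q(2) by simp_all
  have A: "condition_A (toric_class R) a b" using step_A(3) P by simp
  have "incomparable_pairs (toric_class (add_arc R a b)) \<subset> incomparable_pairs (toric_class R)"
    using incomparable_pairs_psubset[OF P(1)] A by (simp add: condition_A_def)
  then have "card (incomparable_pairs (toric_class (add_arc R a b))) < card (incomparable_pairs (toric_class R))"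
    by (intro psubset_card_mono) auto
  then show ?thesis
    using step_A(1,2) P assms(2) condition_A_acyclic[OF P(1) A] total_extensions_step_A[OF P(1) A]
    by (auto simp: weight_def all_extensions_def toric_poset_def)
next
  case (step_B P a b v R' N)
  have "toric_poset P" using assms(2) step_B(1) by simp
  then obtain R where P: "acyclic R" "P = toric_class R"
    unfolding toric_poset_def by blast
  have B: "condition_B (toric_class R) a b v" and R': "R' \<in> toric_closure (toric_class R)"
    using step_B(3,4) P by simp_all
  note B' = condition_B_sym[OF B]
  have ac: "acyclic (add_arc R' a b)" "acyclic (add_arc R' b a)"
    by (rule condition_B_acyclic[OF P(1) B R' step_B(5)],
        rule condition_B_acyclic[OF P(1) B' R' step_B(5)])
  have acR': "acyclic R'" using ac(1) by (rule acyclic_subset) (auto simp: add_arc_def)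
  have "incomparable_pairs (toric_class R') = incomparable_pairs (toric_class R)"
    using torically_comparable_toric_closure[OF P(1) R'] by (simp add: incomparable_pairs_def)
  moreover have "\<not> torically_comparable (toric_class R') a b" "\<not> torically_comparable (toric_class R') b a"
    using B B' torically_comparable_toric_closure[OF P(1) R'] by (simp_all add: condition_B_def)
  ultimately have card: "card (incomparable_pairs (toric_class (add_arc R' a b))) < card (incomparable_pairs P)"
      "card (incomparable_pairs (toric_class (add_arc R' b a))) < card (incomparable_pairs P)"
    using incomparable_pairs_psubset[OF acR'] P(2) by (metis psubset_card_mono finite)+
  have "(3::nat) ^ k + 3 ^ l < 3 ^ m" if "k < m" "l < m" for k l m
  proof -
    obtain m' where m: "m = Suc m'" using \<open>k < m\<close> by (cases m) auto
    have "(3::nat) ^ k \<le> 3 ^ m'" "(3::nat) ^ l \<le> 3 ^ m'" "(0::nat) < 3 ^ m'"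
      using that m by (auto intro: power_increasing)
    then show ?thesis unfolding m power_Suc by linarith
  qed
  from this[OF card] have "weight M' < weight M"
    using step_B(1,2) by (simp add: weight_def)
  \<comment> \<open>Disjointness of the two branches turns their union into a sum of
    multisets.\<close>
  moreover have "all_extensions M' = all_extensions M"
    using step_B(1,2) P(2) total_extensions_step_B[OF P(1) B R' step_B(5)]
    by (simp add: all_extensions_def mset_set_Union finite_toric_total_extensions)
  ultimately show ?thesis
    using step_B(1,2) assms(2) ac by (auto simp: toric_poset_def)
qed

section \<open>Termination and correctness\<close>

lemma algorithm_terminates:
  fixes Q :: "'n::finite rel"
  assumes "acyclic Q"
  shows "\<not> (\<exists>M. M 0 = {#toric_class Q#} \<and> (\<forall>k::nat. algorithm_step (M k) (M (Suc k))))"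
proof
  assume "\<exists>M. M 0 = {#toric_class Q#} \<and> (\<forall>k::nat. algorithm_step (M k) (M (Suc k)))"
  then obtain M where M: "M 0 = {#toric_class Q#}" "\<And>k::nat. algorithm_step (M k) (M (Suc k))"
    by blast
  have inv: "\<forall>P\<in>#M k. toric_poset P" for k
  proof (induction k)
    case 0
    then show ?case using M(1) assms by (auto simp: toric_poset_def)
  next
    case (Suc k)
    then show ?case using algorithm_step_invariant[OF M(2)] by blast
  qed
  have "\<forall>k. (weight (M (Suc k)), weight (M k)) \<in> less_than"
    using algorithm_step_invariant[OF M(2) inv] by simp
  then have "\<exists>f. \<forall>k. (f (Suc k), f k) \<in> less_than"
    by (rule exI[of _ "\<lambda>k. weight (M k)"])
  then show False
    using wf_less_than by (simp add: wf_iff_no_infinite_down_chain)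
qed

lemma terminal_closure_complete:
  fixes M :: "'n::finite rel set multiset"
  assumes "\<nexists>M'. algorithm_step M M'" "P \<in># M" "acyclic R" "P = toric_class R"
  shows "closure_complete P"
proof (rule ccontr)
  assume "\<not> closure_complete P"
  obtain N where N: "M = add_mset P N" using assms(2) by (metis mset_add)
  from condition_exists[OF assms(3)] \<open>\<not> closure_complete P\<close> assms(4)
  consider a b where "condition_A P a b" | a b v where "condition_B P a b v" by blast
  then show False
  proof cases
    case 1
    have "R \<in> P" using assms(4) by simp
    then show False using step_A[OF 1] assms(1) N by blast
  next
    case 2
    obtain R' where "R' \<in> toric_closure P" "is_source v R'"
      using exists_source_in_class[OF acyclic_toric_trancl[OF assms(3)], of v]
        toric_closure_toric_class[OF assms(3)] assms(4) by blast
    then show False using step_B[OF 2] assms(1) N by blast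
  qed
qed

text \<open>In a terminal state each poset has a single total extension, so the invariant multiset
  is the image of the state under the map to that extension. It equals the initial value, in which
  every total extension of [Q] occurs once.\<close>

lemma algorithm_correct:
  fixes Q :: "'n::finite rel"
  assumes "acyclic Q" "algorithm_step\<^sup>*\<^sup>* {#toric_class Q#} M" "\<nexists>M'. algorithm_step M M'"
  shows "rel_mset corresponds M (mset_set (toric_total_extensions (toric_class Q)))"
proof -
  have inv: "(\<forall>P\<in>#M. toric_poset P) \<and> all_extensions M = all_extensions {#toric_class Q#}"
    using assms(2)
  proof induction
    case base
    then show ?case using assms(1) by (auto simp: toric_poset_def)
  next
    case (step M' M'')
    then show ?case using algorithm_step_invariant[of M' M''] by simp
  qed
  have "\<exists>W. toric_total_extensions P = {W} \<and> corresponds P W" if "P \<in># M" for P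
  proof -
    have "toric_poset P" using inv that by blast
    then obtain R where "acyclic R" "P = toric_class R"
      by (auto simp: toric_poset_def)
    then show ?thesis
      using closure_complete_extensions terminal_closure_complete[OF assms(3) that] by blast
  qed
  then obtain f where f: "\<And>P. P \<in># M \<Longrightarrow> toric_total_extensions P = {f P} \<and> corresponds P (f P)"
    by metis
  have "all_extensions M = (\<Sum>P\<in>#M. {#f P#})"
    unfolding all_extensions_def using f by (intro arg_cong[of _ _ sum_mset] image_mset_cong) simp
  also have "\<dots> = image_mset f M"
    by (induction M) auto
  finally have "mset_set (toric_total_extensions (toric_class Q)) = image_mset f M"
    using inv by (simp add: all_extensions_def)
  moreover have "rel_mset corresponds M (image_mset f M)"
    using f
  proof (induction M)
    case empty
    then show ?case by (simp add: rel_mset_Zero)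
  next
    case (add P M)
    then show ?case by (simp add: rel_mset_Plus)
  qed
  ultimately show ?thesis by simp
qed

theorem corollary7p3:
  "(\<forall>R :: 'n::finite rel. acyclic R \<and> \<not> closure_complete (toric_class R) \<longrightarrow>
      ((\<exists>a b. condition_A (toric_class R) a b) \<or> (\<exists>a b v. condition_B (toric_class R) a b v)) \<and>
      (\<forall>a b. condition_A (toric_class R) a b \<longrightarrow>
         acyclic (add_arc R a b) \<and>
         toric_total_extensions (toric_class R) =
           toric_total_extensions (toric_class (add_arc R a b))) \<and>
      (\<forall>a b v R'. condition_B (toric_class R) a b v \<and>
         R' \<in> toric_closure (toric_class R) \<and> is_source v R' \<longrightarrow>
         acyclic (add_arc R' a b) \<and> acyclic (add_arc R' b a) \<and>
         toric_total_extensions (toric_class R) =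
           toric_total_extensions (toric_class (add_arc R' a b)) \<union>
           toric_total_extensions (toric_class (add_arc R' b a)) \<and>
         toric_total_extensions (toric_class (add_arc R' a b)) \<inter>
           toric_total_extensions (toric_class (add_arc R' b a)) = {})) \<and>
   (\<forall>Q :: 'n rel. acyclic Q \<longrightarrow>
      \<not> (\<exists>M. M 0 = {#toric_class Q#} \<and> (\<forall>k::nat. algorithm_step (M k) (M (Suc k)))) \<and>
      (\<forall>M. algorithm_step\<^sup>*\<^sup>* {#toric_class Q#} M \<and> \<not> (\<exists>M'. algorithm_step M M') \<longrightarrow>
         rel_mset corresponds M (mset_set (toric_total_extensions (toric_class Q)))))"
proof (intro conjI allI impI; (elim conjE)?)
  fix R :: "'n rel"
  assume "acyclic R" "\<not> closure_complete (toric_class R)"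
  then show "(\<exists>a b. condition_A (toric_class R) a b) \<or> (\<exists>a b v. condition_B (toric_class R) a b v)"
    by (rule condition_exists)
next
  fix R :: "'n rel" and a b
  assume "acyclic R" "condition_A (toric_class R) a b"
  then show "acyclic (add_arc R a b)"
    "toric_total_extensions (toric_class R) = toric_total_extensions (toric_class (add_arc R a b))"
    by (rule condition_A_acyclic, rule total_extensions_step_A)
next
  fix R :: "'n rel" and a b v R'
  assume *: "acyclic R" "condition_B (toric_class R) a b v"
    "R' \<in> toric_closure (toric_class R)" "is_source v R'"
  show "acyclic (add_arc R' a b)" "acyclic (add_arc R' b a)"
    using condition_B_acyclic[OF *(1) _ *(3,4)] condition_B_sym[OF *(2)] *(2) by blast+
  show "toric_total_extensions (toric_class R) =
      toric_total_extensions (toric_class (add_arc R' a b)) \<union>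
      toric_total_extensions (toric_class (add_arc R' b a))"
    "toric_total_extensions (toric_class (add_arc R' a b)) \<inter>
      toric_total_extensions (toric_class (add_arc R' b a)) = {}"
    using total_extensions_step_B[OF *] by blast+
next
  fix Q :: "'n rel"
  assume "acyclic Q"
  then show "\<not> (\<exists>M. M 0 = {#toric_class Q#} \<and> (\<forall>k::nat. algorithm_step (M k) (M (Suc k))))"
    by (rule algorithm_terminates)
next
  fix Q :: "'n rel" and M
  assume "acyclic Q" "algorithm_step\<^sup>*\<^sup>* {#toric_class Q#} M" "\<nexists>M'. algorithm_step M M'"
  then show "rel_mset corresponds M (mset_set (toric_total_extensions (toric_class Q)))"
    by (rule algorithm_correct)
qed

end
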